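(* Let $0<\alpha<1$, let $U\subseteq\mathbb{C}$ be open, let $x_0\in\overline{U}$, let $0<\lambda<1$ and let $t$ be a non-negative integer. If $$\sum_{n=1}^{\infty}2^{(t+\lambda+1)n}\,M_*^{1+\alpha}(A_n\setminus U)=\infty,$$ then for every representing measure $\mu$ for $x_0$ on $A_\alpha(U)$, $$\mu^{t+\lambda}(x_0)=\int\frac{d|\mu|(\zeta)}{|\zeta-x_0|^{t+\lambda}}=\infty,$$ i.e. $x_0$ is a $(t+\lambda)$-spike for $A_\alpha(U)$.
   Context: For $0<\alpha<1$, $\mathrm{Lip}\alpha(\mathbb{C})$ is the space of functions $f:\mathbb{C}\to\mathbb{C}$ for which there is $k>0$ with $|f(z)-f(w)|\le k|z-w|^\alpha$ for all $z,w$; its norm is $\|f\|_{\mathrm{Lip}\alpha(\mathbb{C})}=\sup|f|+k(f)$, where $k(f)$ is the smallest such $k$. The little Lipschitz class $\mathrm{lip}\alpha(\mathbb{C})$ consists of those $f\in\mathrm{Lip}\alpha(\mathbb{C})$ such that for each $\epsilon>0$ there is $\delta>0$ with $|f(z)-f(w)|\le\epsilon|z-w|^\alpha$ whenever $|z-w|<\delta$. $A_\alpha(U)$ denotes the space of functions in $\mathrm{lip}\alpha(\mathbb{C})$ that are analytic on $U$. $A_n=\{z: 2^{-n-1}<|z-x_0|<2^{-n}\}$. A measure function is a nondecreasing $h:[0,\infty)\to[0,\infty)$; $M_h(E)=\inf\sum h(\operatorname{diam}B)$, the infimum over all countable covers of $E$ by balls $B$. The lower $(1+\alpha)$-dimensional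 Hausdorff content is $M_*^{1+\alpha}(E)=\sup M_h(E)$, the supremum over measure functions $h$ with $h(r)\le r^{1+\alpha}$ and $r^{-1-\alpha}h(r)\to0$ as $r\to0$. A (finite complex Borel) measure $\mu$ is a representing measure for $x_0$ on $A_\alpha(U)$ if $\int f\,d\mu=f(x_0)$ for all $f\in A_\alpha(U)$. For $\tau>0$, $\mu^\tau(z)=\int\frac{d|\mu|(\zeta)}{|\zeta-z|^\tau}$, and $x_0$ is a $\tau$-spike for $A_\alpha(U)$ if $\mu^\tau(x_0)=\infty$ for every representing measure $\mu$ for $x_0$ on $A_\alpha(U)$. *)

theory Defs
  imports "HOL-Analysis.Analysis"
begin

definition Lip :: "real \<Rightarrow> (complex \<Rightarrow> complex) set" where
  "Lip \<alpha> = {f. bounded (range f) \<and>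
     (\<exists>k>0. \<forall>z w. norm (f z - f w) \<le> k * norm (z - w) powr \<alpha>)}"

definition lip :: "real \<Rightarrow> (complex \<Rightarrow> complex) set" where
  "lip \<alpha> = {f. f \<in> Lip \<alpha> \<and>
     (\<forall>\<epsilon>>0. \<exists>\<delta>>0. \<forall>z w. norm (z - w) < \<delta> \<longrightarrow>
        norm (f z - f w) \<le> \<epsilon> * norm (z - w) powr \<alpha>)}"

definition A_alpha :: "real \<Rightarrow> complex set \<Rightarrow> (complex \<Rightarrow> complex) set" where
  "A_alpha \<alpha> U = {f. f \<in> lip \<alpha> \<and> f analytic_on U}"

definition annulus :: "complex \<Rightarrow> nat \<Rightarrow> complex set" where
  "annulus x0 n = {z. 2 powr (- real n - 1) < norm (z - x0) \<and> norm (z - x0) < 2 powr (- real n)}"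

definition measure_function :: "(real \<Rightarrow> real) \<Rightarrow> bool" where
  "measure_function h \<longleftrightarrow> mono_on {0..} h \<and> (\<forall>r\<ge>0. h r \<ge> 0)"

definition M_h :: "(real \<Rightarrow> real) \<Rightarrow> complex set \<Rightarrow> ennreal" where
  "M_h h E = (INF C \<in> {C. countable C \<and> (\<forall>B\<in>C. \<exists>z r. r > 0 \<and> B = ball z r) \<and> E \<subseteq> \<Union>C}.
       (\<integral>\<^sup>+ B. ennreal (h (diameter B)) \<partial>count_space C))"

definition lower_content :: "real \<Rightarrow> complex set \<Rightarrow> ennreal" where
  "lower_content \<alpha> E = (SUP h \<in> {h. measure_function h \<and> (\<forall>r\<ge>0. h r \<le> r powr (1 + \<alpha>)) \<and>
        ((\<lambda>r. h r / r powr (1 + \<alpha>)) \<longlongrightarrow> 0) (at_right 0)}. M_h h E)"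

text \<open>A finite complex Borel measure mu is represented by its polar decomposition
  d mu = g d|mu|, with |mu| = nu a finite positive Borel measure and |g| = 1 nu-a.e.\<close>
definition complex_measure :: "complex measure \<Rightarrow> (complex \<Rightarrow> complex) \<Rightarrow> bool" where
  "complex_measure \<nu> g \<longleftrightarrow> sets \<nu> = sets borel \<and> finite_measure \<nu> \<and>
     g \<in> borel_measurable \<nu> \<and> (AE z in \<nu>. norm (g z) = 1)"

definition representing_measure ::
  "real \<Rightarrow> complex set \<Rightarrow> complex \<Rightarrow> complex measure \<Rightarrow> (complex \<Rightarrow> complex) \<Rightarrow> bool" where
  "representing_measure \<alpha> U x0 \<nu> g \<longleftrightarrow> complex_measure \<nu> g \<and>
     (\<forall>f \<in> A_alpha \<alpha> U. integrable \<nu> (\<lambda>z. f z * g z) \<and>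
        integral\<^sup>L \<nu> (\<lambda>z. f z * g z) = f x0)"

text \<open>mu^tau(z) = integral of |zeta - z|^(-tau) d|mu|(zeta), with 1/0 = infinity\<close>
definition potential :: "complex measure \<Rightarrow> real \<Rightarrow> complex \<Rightarrow> ennreal" where
  "potential \<nu> \<tau> z = (\<integral>\<^sup>+ \<zeta>. inverse (ennreal (norm (\<zeta> - z) powr \<tau>)) \<partial>\<nu>)"

definition spike :: "real \<Rightarrow> real \<Rightarrow> complex set \<Rightarrow> complex \<Rightarrow> bool" where
  "spike \<tau> \<alpha> U x0 \<longleftrightarrow> (\<forall>\<nu> g. representing_measure \<alpha> U x0 \<nu> g \<longrightarrow> potential \<nu> \<tau> x0 = \<infinity>)"

end

theory Submission
  imports Defs
begin

text \<open>
  Write \<open>s\<^sub>n\<close> for the content of the \<open>n\<close>-th annulus minus \<open>U\<close>. Frostman's lemma gives a measure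
  \<open>\<nu>\<^sub>n\<close> of mass comparable to \<open>s\<^sub>n\<close> on the closed annulus minus \<open>U\<close> whose growth is
  \<open>o(r\<^bsup>1+\<alpha>\<^esup>)\<close>: the total content is pushed down a dyadic tree so that each cell receives at most
  its own content, which is possible because the content is subadditive, and the resulting masses
  are realised by consecutive subintervals of an interval with Lebesgue measure.

  With the phase \<open>\<theta>(\<zeta>) = sgn(\<zeta> - x\<^sub>0)\<^bsup>t+1\<^esup>\<close>, let \<open>f\<^sub>n\<close> and \<open>G\<^sub>n\<close> be the Cauchy transforms of
  \<open>\<theta> \<nu>\<^sub>n\<close> and \<open>\<theta> (\<zeta> - x\<^sub>0)\<^bsup>-t\<^esup> \<nu>\<^sub>n\<close>. Then \<open>G\<^sub>n\<close> belongs to \<open>A\<^sub>\<alpha>(U)\<close>, and by partial fractions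
  \<open>f\<^sub>n(z) (z - x\<^sub>0)\<^bsup>-t\<^esup>\<close> equals \<open>G\<^sub>n(z)\<close> plus a combination of \<open>(z - x\<^sub>0)\<^bsup>-j\<^esup>\<close>, \<open>1 \<le> j \<le> t\<close>.
  Integrating against a representing measure \<open>\<mu>\<close> with finite potential yields \<open>G\<^sub>n(x\<^sub>0)\<close>, which is
  real and at least a multiple of \<open>2\<^bsup>(t+1)n\<^esup> s\<^sub>n\<close>, up to terms smaller by a factor \<open>2\<^bsup>-n\<^esup>\<close>. On the
  other hand \<open>|f\<^sub>n(z)| \<le> C min(1, 2\<^bsup>-n\<^esup> / |z - x\<^sub>0|)\<close>, so every finite sum of the \<open>2\<^bsup>\<lambda>n\<^esup> f\<^sub>n\<close> is at
  most \<open>C |z - x\<^sub>0|\<^bsup>-\<lambda>\<^esup>\<close>. Hence the partial sums of \<open>2\<^bsup>(t+\<lambda>+1)n\<^esup> s\<^sub>n\<close> are bounded by a multiple of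
  the potential of order \<open>t + \<lambda>\<close>.
\<close>

section \<open>Distributing mass along a binary tree\<close>

text \<open>A word lists the branches on the way from the root to a node, the last one first.\<close>

locale subadditive_tree =
  fixes weight :: "bool list \<Rightarrow> real"
  assumes weight_nonneg: "0 \<le> weight w"
    and weight_le_children: "weight w \<le> weight (False # w) + weight (True # w)"
begin

primrec mass :: "bool list \<Rightarrow> real" where
  "mass [] = weight []"
| "mass (b # w) = (if b then mass w - min (mass w) (weight (False # w))
                   else min (mass w) (weight (False # w)))"

primrec left_end :: "bool list \<Rightarrow> real" where
  "left_end [] = 0"
| "left_end (b # w) = left_end w + (if b then mass (False # w) else 0)"

definition slot :: "bool list \<Rightarrow> real set" where
  "slot w = {left_end w ..< left_end w + mass w}"

primrec address :: "nat \<Rightarrow> real \<Rightarrow> bool list" where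
  "address 0 x = []"
| "address (Suc n) x = (left_end (True # address n x) \<le> x) # address n x"

lemma length_address [simp]: "length (address n x) = n"
  by (induction n) auto

lemma mass_nonneg: "0 \<le> mass w"
proof (induction w)
  case Nil
  then show ?case by (simp add: weight_nonneg)
next
  case (Cons b w)
  then show ?case using weight_nonneg[of "False # w"] by simp
qed

lemma mass_le_weight: "mass w \<le> weight w"
proof (induction w)
  case Nil
  then show ?case by simp
next
  case (Cons b w)
  then show ?case
    using weight_nonneg[of "True # w"] weight_le_children[of w] by (cases b) auto
qed

lemma slot_Cons_subset: "slot (b # w) \<subseteq> slot w"
  using mass_nonneg[of w] weight_nonneg[of "False # w"] by (auto simp: slot_def split: if_splits)

lemma slot_subset_root: "slot w \<subseteq> slot []"
  using slot_Cons_subset by (induction w) blast+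

lemma mem_slot_address: "x \<in> slot [] \<Longrightarrow> x \<in> slot (address n x)"
  by (induction n) (auto simp: slot_def)

lemma address_of_mem_slot: "x \<in> slot w \<Longrightarrow> address (length w) x = w"
proof (induction w)
  case Nil
  then show ?case by simp
next
  case (Cons b w)
  then have "address (length w) x = w" using slot_Cons_subset by blast
  then show ?case using Cons.prems by (auto simp: slot_def split: if_splits)
qed

lemma slot_in_sets_restrict_space [simp]: "slot w \<in> sets (restrict_space lborel (slot []))"
  using slot_subset_root[of w] by (auto simp: sets_restrict_space_iff slot_def)

lemma measurable_address:
  "address n \<in> measurable (restrict_space lborel (slot [])) (count_space UNIV)"
proof -
  have "address n -` {w} \<inter> slot [] \<in> sets (restrict_space lborel (slot []))" for w
  proof (cases "length w = n")
    case True
    then have "address n -` {w} \<inter> slot [] = slot w"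
      using mem_slot_address[where n = n] address_of_mem_slot[where w = w] slot_subset_root[of w]
      by blast
    then show ?thesis by simp
  next
    case False
    then have "address n -` {w} \<inter> slot [] = {}" by auto
    then show ?thesis by simp
  qed
  then show ?thesis
    by (subst measurable_count_space_eq_countable) (auto simp: space_restrict_space)
qed

end

lemma finite_words: "finite {w :: bool list. length w = n \<and> P w}"
  by (rule finite_subset[OF _ finite_lists_length_eq[of UNIV n]]) auto

locale shrinking_tree = subadditive_tree weight
  for weight :: "bool list \<Rightarrow> real" +
  fixes cell :: "bool list \<Rightarrow> 'a :: {complete_space, second_countable_topology} set"
    and \<delta> :: "nat \<Rightarrow> real"
  assumes cell_Cons_subset: "cell (b # w) \<subseteq> cell w"
    and weight_eq_0: "cell w = {} \<Longrightarrow> weight w = 0"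
    and closed_root: "closed (cell [])"
    and dist_cell_le: "y \<in> cell w \<Longrightarrow> z \<in> cell w \<Longrightarrow> dist y z \<le> \<delta> (length w)"
    and \<delta>_tendsto_0: "\<delta> \<longlonglongrightarrow> 0"
begin

definition sample :: "nat \<Rightarrow> real \<Rightarrow> 'a" where
  "sample n x = (SOME z. z \<in> cell (address n x))"

definition limit_point :: "real \<Rightarrow> 'a" where
  "limit_point x = lim (\<lambda>n. sample n x)"

definition tree_measure :: "'a measure" where
  "tree_measure = distr (restrict_space lborel (slot [])) borel limit_point"

lemma sample_in_cell:
  assumes "x \<in> slot []" "m \<le> n"
  shows "sample n x \<in> cell (address m x)"
proof -
  have "0 < mass (address n x)" using mem_slot_address[OF assms(1), of n] by (auto simp: slot_def)
  then have "cell (address n x) \<noteq> {}"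
    using mass_le_weight[of "address n x"] weight_eq_0 by fastforce
  then have "sample n x \<in> cell (address n x)" unfolding sample_def by (simp add: some_in_eq)
  moreover have "cell (address n x) \<subseteq> cell (address m x)"
    by (rule lift_Suc_antimono_le[OF _ assms(2)]) (simp add: cell_Cons_subset)
  ultimately show ?thesis by blast
qed

lemma dist_sample_le:
  assumes "x \<in> slot []" "m \<le> n"
  shows "dist (sample n x) (sample m x) \<le> \<delta> m"
  using dist_cell_le[OF sample_in_cell[OF assms] sample_in_cell[OF assms(1) order_refl]] by simp

lemma sample_tendsto_limit_point:
  assumes "x \<in> slot []"
  shows "(\<lambda>n. sample n x) \<longlonglongrightarrow> limit_point x"
proof -
  have "Cauchy (\<lambda>n. sample n x)"
  proof (rule metric_CauchyI)
    fix e :: real assume "0 < e"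
    then obtain M where "\<delta> M < e / 2"
      using order_tendstoD(2)[OF \<delta>_tendsto_0, of "e / 2"] by (auto simp: eventually_sequentially)
    then have "dist (sample m x) (sample n x) < e" if "m \<ge> M" "n \<ge> M" for m n
      using dist_sample_le[OF assms that(1)] dist_sample_le[OF assms that(2)]
        dist_triangle2[of "sample m x" "sample n x" "sample M x"] by simp
    then show "\<exists>M. \<forall>m\<ge>M. \<forall>n\<ge>M. dist (sample m x) (sample n x) < e" by blast
  qed
  then show ?thesis
    unfolding limit_point_def by (simp add: Cauchy_convergent convergent_LIMSEQ_iff[symmetric])
qed

lemma dist_sample_limit_point_le:
  assumes "x \<in> slot []"
  shows "dist (sample n x) (limit_point x) \<le> \<delta> n"
proof -
  have "(\<lambda>k. dist (sample k x) (sample n x)) \<longlonglongrightarrow> dist (limit_point x) (sample n x)"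
    by (intro tendsto_dist sample_tendsto_limit_point assms tendsto_const)
  then have "dist (limit_point x) (sample n x) \<le> \<delta> n"
    by (rule LIMSEQ_le_const2) (use dist_sample_le[OF assms] in blast)
  then show ?thesis by (simp add: dist_commute)
qed

lemma limit_point_in_root:
  assumes "x \<in> slot []"
  shows "limit_point x \<in> cell []"
  by (rule closed_sequentially[OF closed_root _ sample_tendsto_limit_point[OF assms]])
    (use sample_in_cell[OF assms, of 0] in simp)

lemma measurable_limit_point:
  "limit_point \<in> borel_measurable (restrict_space lborel (slot []))"
proof (rule borel_measurable_LIMSEQ_metric[where f = sample])
  show "sample n \<in> borel_measurable (restrict_space lborel (slot []))" for n
    unfolding sample_def by (rule measurable_compose[OF measurable_address]) simp
qed (simp add: space_restrict_space sample_tendsto_limit_point)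

lemma sets_tree_measure [simp]: "sets tree_measure = sets borel"
  by (simp add: tree_measure_def)

lemma emeasure_slot: "emeasure (restrict_space lborel (slot [])) (slot w) = ennreal (mass w)"
  using slot_subset_root[of w] mass_nonneg[of w]
  by (subst emeasure_restrict_space) (auto simp: slot_def)

lemma emeasure_tree_measure:
  assumes "S \<in> sets borel"
  shows "emeasure tree_measure S
    = emeasure (restrict_space lborel (slot [])) (limit_point -` S \<inter> slot [])"
  unfolding tree_measure_def using assms
  by (subst emeasure_distr[OF measurable_limit_point]) (auto simp: space_restrict_space)

lemma emeasure_tree_measure_UNIV: "emeasure tree_measure UNIV = ennreal (weight [])"
  using emeasure_slot[of "[]"] by (simp add: emeasure_tree_measure)

lemma finite_measure_tree_measure: "finite_measure tree_measure"
  by (rule finite_measureI) (use emeasure_tree_measure_UNIV in \<open>simp add: tree_measure_def\<close>)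

lemma AE_tree_measure: "AE z in tree_measure. z \<in> cell []"
  unfolding tree_measure_def using closed_root
  by (subst AE_distr_iff[OF measurable_limit_point])
    (auto simp: space_restrict_space limit_point_in_root borel_closed)

lemma emeasure_tree_measure_le:
  assumes "S \<in> sets borel"
  shows "emeasure tree_measure S
    \<le> ennreal (\<Sum>w | length w = n \<and> (\<exists>y\<in>cell w. \<exists>z\<in>S. dist y z \<le> \<delta> n). weight w)"
proof -
  let ?L = "restrict_space lborel (slot [])"
  let ?W = "{w. length w = n \<and> (\<exists>y\<in>cell w. \<exists>z\<in>S. dist y z \<le> \<delta> n)}"
  have "finite ?W" by (rule finite_words)
  have "limit_point -` S \<inter> slot [] \<subseteq> (\<Union>w\<in>?W. slot w)"
  proof
    fix x assume x: "x \<in> limit_point -` S \<inter> slot []"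
    then have "address n x \<in> ?W"
      using sample_in_cell[of x n n] dist_sample_limit_point_le[of x n] by auto
    then show "x \<in> (\<Union>w\<in>?W. slot w)" using mem_slot_address x by blast
  qed
  then have "emeasure tree_measure S \<le> emeasure ?L (\<Union>w\<in>?W. slot w)"
    unfolding emeasure_tree_measure[OF assms] using \<open>finite ?W\<close>
    by (intro emeasure_mono sets.finite_UN) auto
  also have "\<dots> \<le> (\<Sum>w\<in>?W. emeasure ?L (slot w))"
    using \<open>finite ?W\<close> by (intro emeasure_subadditive_finite) auto
  also have "\<dots> = ennreal (\<Sum>w\<in>?W. mass w)" by (simp add: emeasure_slot mass_nonneg)
  also have "\<dots> \<le> ennreal (\<Sum>w\<in>?W. weight w)" by (intro ennreal_leI sum_mono mass_le_weight)
  finally show ?thesis .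
qed

end

section \<open>Contents\<close>

definition ball_cover :: "complex set \<Rightarrow> complex set set \<Rightarrow> bool" where
  "ball_cover E C \<longleftrightarrow> countable C \<and> (\<forall>B\<in>C. \<exists>z r. r > 0 \<and> B = ball z r) \<and> E \<subseteq> \<Union>C"

definition cover_cost :: "(real \<Rightarrow> real) \<Rightarrow> complex set set \<Rightarrow> ennreal" where
  "cover_cost h C = (\<integral>\<^sup>+B. ennreal (h (diameter B)) \<partial>count_space C)"

lemma M_h_eq: "M_h h E = (INF C \<in> Collect (ball_cover E). cover_cost h C)"
  by (simp add: M_h_def ball_cover_def[abs_def] cover_cost_def)

lemma ball_cover_Un: "ball_cover E C \<Longrightarrow> ball_cover F D \<Longrightarrow> ball_cover (E \<union> F) (C \<union> D)"
  by (auto simp: ball_cover_def)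

lemma cover_cost_Un_le: "cover_cost h (C \<union> D) \<le> cover_cost h C + cover_cost h D"
proof -
  let ?u = "\<lambda>B. ennreal (h (diameter B))"
  have "cover_cost h (C \<union> D) = (\<integral>\<^sup>+B\<in>C \<union> D. ?u B \<partial>count_space UNIV)"
    by (simp add: cover_cost_def nn_integral_count_space_indicator)
  also have "\<dots> \<le> (\<integral>\<^sup>+B. ?u B * indicator C B + ?u B * indicator D B \<partial>count_space UNIV)"
    by (intro nn_integral_mono) (auto simp: indicator_def)
  also have "\<dots> = cover_cost h C + cover_cost h D"
    by (subst nn_integral_add) (auto simp: cover_cost_def nn_integral_count_space_indicator)
  finally show ?thesis .
qed

lemma M_h_le_cover_cost: "ball_cover E C \<Longrightarrow> M_h h E \<le> cover_cost h C"
  unfolding M_h_eq by (rule INF_lower) simp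

lemma M_h_mono: "E \<subseteq> F \<Longrightarrow> M_h h E \<le> M_h h F"
  unfolding M_h_def by (rule INF_superset_mono) auto

lemma M_h_empty [simp]: "M_h h {} = 0"
  using M_h_le_cover_cost[of "{}" "{}" h]
  by (simp add: ball_cover_def cover_cost_def nn_integral_count_space_finite)

lemma M_h_subset_ball:
  assumes "E \<subseteq> ball z r" "r > 0"
  shows "M_h h E \<le> ennreal (h (2 * r))"
  using M_h_le_cover_cost[of E "{ball z r}" h] assms
  by (auto simp: ball_cover_def cover_cost_def nn_integral_count_space_finite)

lemma M_h_near_optimal_cover:
  assumes "M_h h E < top" "0 < e"
  obtains C where "ball_cover E C" "cover_cost h C < M_h h E + ennreal e"
proof -
  have "M_h h E < M_h h E + ennreal e"
    using assms by (simp add: ennreal_add_left_cancel_less[of _ 0, simplified])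
  then show ?thesis using that unfolding M_h_eq INF_less_iff by auto
qed

lemma M_h_Un: "M_h h (E \<union> F) \<le> M_h h E + M_h h F"
proof (rule ennreal_le_epsilon)
  fix e :: real assume finite: "M_h h E + M_h h F < top" and "0 < e"
  then have "0 < e / 2" by simp
  obtain C where C: "ball_cover E C" "cover_cost h C < M_h h E + ennreal (e / 2)"
    using M_h_near_optimal_cover[of h E "e / 2"] finite \<open>0 < e / 2\<close> by auto
  obtain D where D: "ball_cover F D" "cover_cost h D < M_h h F + ennreal (e / 2)"
    using M_h_near_optimal_cover[of h F "e / 2"] finite \<open>0 < e / 2\<close> by auto
  have "M_h h (E \<union> F) \<le> cover_cost h (C \<union> D)"
    by (rule M_h_le_cover_cost) (rule ball_cover_Un[OF C(1) D(1)])
  also have "\<dots> \<le> cover_cost h C + cover_cost h D" by (rule cover_cost_Un_le)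
  also have "\<dots> \<le> (M_h h E + ennreal (e / 2)) + (M_h h F + ennreal (e / 2))"
    using C(2) D(2) by (intro add_mono) auto
  also have "\<dots> = M_h h E + M_h h F + (ennreal (e / 2) + ennreal (e / 2))" by (simp add: ac_simps)
  also have "ennreal (e / 2) + ennreal (e / 2) = ennreal e"
    using \<open>0 < e\<close> by (subst ennreal_plus[symmetric]) auto
  finally show "M_h h (E \<union> F) \<le> M_h h E + M_h h F + ennreal e" .
qed

definition lower_gauge :: "real \<Rightarrow> (real \<Rightarrow> real) \<Rightarrow> bool" where
  "lower_gauge \<alpha> h \<longleftrightarrow> measure_function h \<and> (\<forall>r\<ge>0. h r \<le> r powr (1 + \<alpha>)) \<and>
     ((\<lambda>r. h r / r powr (1 + \<alpha>)) \<longlongrightarrow> 0) (at_right 0)"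

lemma lower_content_eq: "lower_content \<alpha> E = (SUP h \<in> Collect (lower_gauge \<alpha>). M_h h E)"
  by (simp add: lower_content_def lower_gauge_def[abs_def])

lemma lower_content_subset_ball_less_top:
  assumes "E \<subseteq> ball x r" "0 < r"
  shows "lower_content \<alpha> E < top"
proof -
  have "M_h h E \<le> ennreal ((2 * r) powr (1 + \<alpha>))" if "lower_gauge \<alpha> h" for h
    using M_h_subset_ball[OF assms, of h] that assms(2)
    by (auto simp: lower_gauge_def intro: order_trans ennreal_leI)
  then have "lower_content \<alpha> E \<le> ennreal ((2 * r) powr (1 + \<alpha>))"
    unfolding lower_content_eq by (intro SUP_least) simp
  then show ?thesis by (rule le_less_trans) simp
qed

lemma lower_content_le_twice_M_h:
  assumes "lower_content \<alpha> E < top"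
  obtains h where "lower_gauge \<alpha> h" "lower_content \<alpha> E \<le> 2 * M_h h E"
proof (cases "lower_content \<alpha> E = 0")
  case True
  have "lower_gauge \<alpha> (\<lambda>_. 0)" by (auto simp: lower_gauge_def measure_function_def mono_on_def)
  then show ?thesis using True by (intro that) simp_all
next
  case False
  then obtain x where x: "lower_content \<alpha> E = ennreal x" "0 < x"
    using assms by (cases "lower_content \<alpha> E") (auto simp: ennreal_eq_0_iff not_le)
  then have "ennreal (x / 2) < lower_content \<alpha> E" by (simp add: ennreal_less_iff)
  then obtain h where h: "lower_gauge \<alpha> h" "ennreal (x / 2) < M_h h E"
    unfolding lower_content_eq less_SUP_iff by blast
  have "ennreal x = 2 * ennreal (x / 2)"
    using x by (simp add: ennreal_mult'[symmetric] flip: ennreal_numeral)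
  also have "\<dots> \<le> 2 * M_h h E" using h(2) by (intro mult_left_mono) auto
  finally show ?thesis using h(1) x(1) that by simp
qed

section \<open>Frostman's lemma\<close>

text \<open>Dyadic rectangles are halved alternately in the real and in the imaginary direction.\<close>

definition dyadic_code :: "nat \<Rightarrow> complex \<Rightarrow> int \<times> int" where
  "dyadic_code n z = (\<lfloor>2 ^ (Suc n div 2) * Re z\<rfloor>, \<lfloor>2 ^ (n div 2) * Im z\<rfloor>)"

primrec corner :: "bool list \<Rightarrow> int \<times> int" where
  "corner [] = (0, 0)"
| "corner (b # w) = (if even (length w) then map_prod (\<lambda>m. 2 * m + of_bool b) id (corner w)
                     else map_prod id (\<lambda>m. 2 * m + of_bool b) (corner w))"

definition grid_coord :: "complex \<Rightarrow> real \<Rightarrow> complex \<Rightarrow> complex" where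
  "grid_coord c L z = (z - c) /\<^sub>R L"

definition dyadic_cell :: "complex \<Rightarrow> real \<Rightarrow> complex set \<Rightarrow> bool list \<Rightarrow> complex set" where
  "dyadic_cell c L K w = {z \<in> K. dyadic_code (length w) (grid_coord c L z) = corner w}"

lemma floor_eq_iff_floor_double:
  fixes x :: real
  shows "\<lfloor>x\<rfloor> = m \<longleftrightarrow> (\<exists>b. \<lfloor>2 * x\<rfloor> = 2 * m + of_bool b)"
  unfolding ex_bool_eq floor_eq_iff by auto

lemma dyadic_code_eq_corner_iff:
  "dyadic_code (length w) z = corner w \<longleftrightarrow> (\<exists>b. dyadic_code (length (b # w)) z = corner (b # w))"
proof (cases "even (length w)")
  case True
  then obtain k where "length w = 2 * k" by blast
  then show ?thesis
    using floor_eq_iff_floor_double[of "2 ^ k * Re z" "fst (corner w)"]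
    by (cases "corner w") (auto simp: dyadic_code_def mult.assoc)
next
  case False
  then obtain k where "length w = Suc (2 * k)" by (auto elim: oddE)
  then show ?thesis
    using floor_eq_iff_floor_double[of "2 ^ k * Im z" "snd (corner w)"]
    by (cases "corner w") (auto simp: dyadic_code_def mult.assoc)
qed

lemma corner_eq_iff: "length v = length w \<Longrightarrow> corner v = corner w \<longleftrightarrow> v = w"
proof (induction v w rule: list_induct2)
  case Nil
  then show ?case by simp
next
  case (Cons a v b w)
  have "2 * k + of_bool a = 2 * m + of_bool b \<longleftrightarrow> k = m \<and> a = b" for k m :: int
    by (cases a; cases b) (auto, presburger+)
  then show ?case using Cons by (cases "corner v"; cases "corner w") auto
qed

lemma dyadic_cell_split:
  "dyadic_cell c L K w = dyadic_cell c L K (False # w) \<union> dyadic_cell c L K (True # w)"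
  unfolding dyadic_cell_def dyadic_code_eq_corner_iff[of w] ex_bool_eq by blast

lemma bounded_obtains_dyadic_root:
  assumes "bounded K"
  obtains c L where "0 < L" "dyadic_cell c L K [] = K"
proof -
  obtain B where B: "0 < B" "\<And>z. z \<in> K \<Longrightarrow> cmod z < B"
    using assms bounded_pos_less by blast
  have "dyadic_cell (- Complex B B) (2 * B) K [] = K"
  proof -
    have "dyadic_code 0 (grid_coord (- Complex B B) (2 * B) z) = (0, 0)" if "z \<in> K" for z
      using B(1) B(2)[OF that] abs_Re_le_cmod[of z] abs_Im_le_cmod[of z]
      by (auto simp: dyadic_code_def grid_coord_def floor_eq_iff field_simps)
    then show ?thesis by (auto simp: dyadic_cell_def)
  qed
  then show ?thesis by (rule that[rotated]) (use B(1) in simp)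
qed

lemma abs_diff_less_of_floor_eq:
  assumes "\<lfloor>2 ^ m * u\<rfloor> = \<lfloor>2 ^ m * (v :: real)\<rfloor>" "k \<le> m"
  shows "\<bar>u - v\<bar> < (1 / 2) ^ k"
proof -
  have "\<bar>2 ^ m * u - 2 ^ m * v\<bar> < 1" using assms(1) by linarith
  then have "2 ^ m * \<bar>u - v\<bar> < 1" by (simp add: abs_mult flip: right_diff_distrib)
  then have "\<bar>u - v\<bar> < (1 / 2) ^ m" by (simp add: field_simps)
  also have "\<dots> \<le> (1 / 2) ^ k" using assms(2) by (intro power_decreasing) auto
  finally show ?thesis .
qed

lemma dist_less_of_dyadic_code_eq:
  assumes "dyadic_code n y = dyadic_code n z"
  shows "dist y z < 2 * (1 / 2) ^ (n div 2)"
proof -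
  have "\<bar>Re y - Re z\<bar> < (1 / 2) ^ (n div 2)"
    by (rule abs_diff_less_of_floor_eq[of "Suc n div 2"])
      (use assms in \<open>auto simp: dyadic_code_def\<close>)
  moreover have "\<bar>Im y - Im z\<bar> < (1 / 2) ^ (n div 2)"
    by (rule abs_diff_less_of_floor_eq[of "n div 2"]) (use assms in \<open>auto simp: dyadic_code_def\<close>)
  ultimately show ?thesis using cmod_le[of "y - z"] by (simp add: dist_norm)
qed

lemma dist_grid_coord:
  assumes "0 < L"
  shows "dist (grid_coord c L y) (grid_coord c L z) = dist y z / L"
  using assms by (simp add: grid_coord_def dist_norm divide_inverse_commute flip: scaleR_diff_right)

lemma dist_dyadic_cell_less:
  assumes "0 < L" "y \<in> dyadic_cell c L K w" "z \<in> dyadic_cell c L K w"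
  shows "dist y z < 2 * L * (1 / 2) ^ (length w div 2)"
  using dist_less_of_dyadic_code_eq[of "length w" "grid_coord c L y" "grid_coord c L z"] assms
  by (simp add: dyadic_cell_def dist_grid_coord field_simps)

lemma floor_scaled_in_interval:
  fixes u v :: real
  assumes "\<bar>u - v\<bar> \<le> 3 * (1 / 2) ^ k"
  shows "\<lfloor>2 ^ k * u\<rfloor> \<in> {\<lfloor>2 ^ k * v\<rfloor> - 3 .. \<lfloor>2 ^ k * v\<rfloor> + 3}"
proof -
  have "2 ^ k * \<bar>u - v\<bar> \<le> 2 ^ k * (3 * (1 / 2) ^ k)" using assms by (intro mult_left_mono) auto
  also have "\<dots> = 3" by (simp add: power_divide)
  finally have "\<bar>2 ^ k * u - 2 ^ k * v\<bar> \<le> 3" by (simp add: abs_mult flip: right_diff_distrib)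
  then show ?thesis unfolding atLeastAtMost_iff by linarith
qed

lemma card_dyadic_cells_near:
  assumes "0 < L"
  shows "card {w. length w = 2 * k \<and> (\<exists>y\<in>dyadic_cell c L K w. dist y z \<le> 3 * L * (1 / 2) ^ k)} \<le> 49"
    (is "card ?W \<le> 49")
proof -
  define box where "box m = {m - 3 .. m + 3 :: int}" for m
  define z' where "z' = grid_coord c L z"
  let ?I = "box \<lfloor>2 ^ k * Re z'\<rfloor> \<times> box \<lfloor>2 ^ k * Im z'\<rfloor>"
  have "corner w \<in> ?I" if "w \<in> ?W" for w
  proof -
    from that obtain y where y: "length w = 2 * k" "y \<in> dyadic_cell c L K w"
      "dist y z \<le> 3 * L * (1 / 2) ^ k" by blast
    define y' where "y' = grid_coord c L y"
    have "dist y z / L \<le> 3 * (1 / 2) ^ k"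
      using y(3) \<open>0 < L\<close> by (simp add: pos_divide_le_eq mult_ac)
    then have "cmod (y' - z') \<le> 3 * (1 / 2) ^ k"
      using \<open>0 < L\<close> by (simp add: y'_def z'_def dist_grid_coord flip: dist_norm)
    then have "\<bar>Re y' - Re z'\<bar> \<le> 3 * (1 / 2) ^ k" "\<bar>Im y' - Im z'\<bar> \<le> 3 * (1 / 2) ^ k"
      using abs_Re_le_cmod[of "y' - z'"] abs_Im_le_cmod[of "y' - z'"] by simp_all
    then have "dyadic_code (2 * k) y' \<in> ?I"
      unfolding box_def dyadic_code_def using floor_scaled_in_interval by simp
    then show ?thesis using y(1,2) by (simp add: dyadic_cell_def y'_def)
  qed
  then have "corner ` ?W \<subseteq> ?I" by blast
  moreover have "inj_on corner ?W" by (rule inj_onI) (simp add: corner_eq_iff)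
  moreover have "finite ?I" by (simp add: box_def)
  ultimately have "card ?W \<le> card ?I" by (simp add: card_inj_on_le)
  then show ?thesis by (simp add: box_def)
qed

lemma dyadic_scale:
  fixes r :: real
  assumes "0 < r" "r \<le> 1"
  obtains k where "(1 / 2) ^ Suc k < r" "r \<le> (1 / 2) ^ k"
proof -
  obtain m where "(1 / 2) ^ m < r" using real_arch_pow_inv[of r "1 / 2"] assms(1) by force
  moreover have "\<not> (1 / 2) ^ 0 < r" using assms(2) by simp
  ultimately obtain k where "\<forall>i\<le>k. \<not> (1 / 2) ^ i < r" "(1 / 2) ^ Suc k < r"
    using ex_least_nat_less[of "\<lambda>k. (1 / 2) ^ k < r" m] by auto
  then show ?thesis using that not_less by blast
qed

locale dyadic_content =
  fixes h :: "real \<Rightarrow> real" and c :: complex and L :: real and K :: "complex set"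
  assumes measure_function: "measure_function h" and compact: "compact K"
    and side_pos: "0 < L" and root: "dyadic_cell c L K [] = K"
begin

abbreviation cell :: "bool list \<Rightarrow> complex set" where
  "cell \<equiv> dyadic_cell c L K"

definition weight :: "bool list \<Rightarrow> real" where
  "weight w = enn2real (M_h h (cell w))"

lemma h_nonneg: "0 \<le> r \<Longrightarrow> 0 \<le> h r"
  using measure_function by (auto simp: measure_function_def)

lemma h_mono: "0 \<le> r \<Longrightarrow> r \<le> s \<Longrightarrow> h r \<le> h s"
  using measure_function by (auto simp: measure_function_def mono_on_def)

lemma M_h_cell_le: "M_h h (cell w) \<le> ennreal (h (4 * L * (1 / 2) ^ (length w div 2)))"
proof (cases "cell w = {}")
  case False
  then obtain y where "y \<in> cell w" by blast
  then have "cell w \<subseteq> ball y (2 * L * (1 / 2) ^ (length w div 2))"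
    using dist_dyadic_cell_less[OF side_pos] by (auto simp: dist_commute)
  from M_h_subset_ball[OF this, of h] show ?thesis using side_pos by (simp add: mult.assoc)
qed simp

lemma ennreal_weight: "ennreal (weight w) = M_h h (cell w)"
  using le_less_trans[OF M_h_cell_le[of w] ennreal_less_top] by (simp add: weight_def)

lemma weight_le: "weight w \<le> h (4 * L * (1 / 2) ^ (length w div 2))"
  using M_h_cell_le[of w] h_nonneg side_pos by (simp flip: ennreal_weight)

sublocale shrinking_tree weight cell "\<lambda>n. 2 * L * (1 / 2) ^ (n div 2)"
proof
  fix w
  show "0 \<le> weight w" by (simp add: weight_def)
  show "weight w \<le> weight (False # w) + weight (True # w)"
  proof -
    have "ennreal (weight w) \<le> ennreal (weight (False # w)) + ennreal (weight (True # w))"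
      unfolding ennreal_weight dyadic_cell_split[of c L K w] by (rule M_h_Un)
    then show ?thesis by (simp add: weight_def flip: ennreal_plus)
  qed
  show "cell (b # w) \<subseteq> cell w" for b
    using dyadic_cell_split[of c L K w] by (cases b) auto
  show "weight w = 0" if "cell w = {}" using that by (simp add: weight_def)
  show "closed (cell [])" using compact root by (simp add: compact_imp_closed)
  show "dist y z \<le> 2 * L * (1 / 2) ^ (length w div 2)" if "y \<in> cell w" "z \<in> cell w" for y z
    using dist_dyadic_cell_less[OF side_pos that] by simp
next
  have "filterlim (\<lambda>n::nat. n div 2) sequentially sequentially"
    unfolding filterlim_at_top eventually_sequentially
  proof
    show "\<exists>N. \<forall>n\<ge>N. Z \<le> n div 2" for Z :: nat by (rule exI[of _ "2 * Z"]) auto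
  qed
  then have "(\<lambda>n. (1 / 2 :: real) ^ (n div 2)) \<longlonglongrightarrow> 0"
    by (rule filterlim_compose[rotated]) (simp add: LIMSEQ_power_zero)
  then show "(\<lambda>n. 2 * L * (1 / 2) ^ (n div 2)) \<longlonglongrightarrow> 0" by (rule tendsto_mult_right_zero)
qed

lemma emeasure_tree_measure_cball_dyadic_le:
  assumes "r \<le> L * (1 / 2) ^ k"
  shows "emeasure tree_measure (cball z r) \<le> ennreal (49 * h (4 * L * (1 / 2) ^ k))"
proof -
  let ?W = "{w. length w = 2 * k \<and>
    (\<exists>y\<in>cell w. \<exists>z'\<in>cball z r. dist y z' \<le> 2 * L * (1 / 2) ^ (2 * k div 2))}"
  let ?near = "{w. length w = 2 * k \<and> (\<exists>y\<in>cell w. dist y z \<le> 3 * L * (1 / 2) ^ k)}"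
  have "?W \<subseteq> ?near"
  proof
    fix w assume "w \<in> ?W"
    then obtain y z' where y: "length w = 2 * k" "y \<in> cell w"
      and "dist z z' \<le> r" "dist y z' \<le> 2 * L * (1 / 2) ^ k" by auto
    then have "dist y z \<le> 3 * L * (1 / 2) ^ k" using dist_triangle2[of y z z'] assms by simp
    with y show "w \<in> ?near" by blast
  qed
  then have "card ?W \<le> card ?near" by (rule card_mono[OF finite_words])
  then have "card ?W \<le> 49" using card_dyadic_cells_near[OF side_pos, of k c K z] by linarith
  have "weight w \<le> h (4 * L * (1 / 2) ^ k)" if "w \<in> ?W" for w using weight_le[of w] that by auto
  then have "(\<Sum>w\<in>?W. weight w) \<le> of_nat (card ?W) * h (4 * L * (1 / 2) ^ k)"
    by (rule sum_bounded_above)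
  also have "\<dots> \<le> 49 * h (4 * L * (1 / 2) ^ k)"
    using \<open>card ?W \<le> 49\<close> side_pos by (intro mult_right_mono h_nonneg) auto
  finally show ?thesis
    using emeasure_tree_measure_le[of "cball z r" "2 * k"] by (auto intro: order_trans ennreal_leI)
qed

lemma emeasure_tree_measure_cball_le:
  assumes "0 < r"
  shows "emeasure tree_measure (cball z r) \<le> ennreal (49 * h (8 * r))"
proof (cases "r \<le> L")
  case False
  have "emeasure tree_measure (cball z r) \<le> emeasure tree_measure UNIV"
    by (intro emeasure_mono) auto
  also have "\<dots> \<le> ennreal (h (4 * L))"
    using weight_le[of "[]"] by (simp add: emeasure_tree_measure_UNIV ennreal_leI)
  also have "\<dots> \<le> ennreal (49 * h (8 * r))"
    using h_mono[of "4 * L" "8 * r"] h_nonneg[of "8 * r"] False side_pos by (intro ennreal_leI) simp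
  finally show ?thesis .
next
  case True
  then obtain k where "(1 / 2) ^ Suc k < r / L" "r / L \<le> (1 / 2) ^ k"
    using assms side_pos dyadic_scale[of "r / L"] by auto
  then have k: "4 * L * (1 / 2) ^ k \<le> 8 * r" "r \<le> L * (1 / 2) ^ k"
    using side_pos by (auto simp: field_simps)
  have "emeasure tree_measure (cball z r) \<le> ennreal (49 * h (4 * L * (1 / 2) ^ k))"
    by (rule emeasure_tree_measure_cball_dyadic_le[OF k(2)])
  also have "\<dots> \<le> ennreal (49 * h (8 * r))"
    using h_mono[OF _ k(1)] side_pos by (intro ennreal_leI) simp
  finally show ?thesis .
qed

end

theorem frostman:
  assumes "compact K" "measure_function h"
  obtains \<nu> :: "complex measure" where "sets \<nu> = sets borel" "finite_measure \<nu>"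
    "emeasure \<nu> UNIV = M_h h K" "AE z in \<nu>. z \<in> K"
    "\<And>z r. 0 < r \<Longrightarrow> emeasure \<nu> (cball z r) \<le> ennreal (49 * h (8 * r))"
proof -
  obtain c L where "0 < L" "dyadic_cell c L K [] = K"
    using bounded_obtains_dyadic_root[OF compact_imp_bounded[OF assms(1)]] .
  then interpret dyadic_content h c L K using assms by unfold_locales
  show ?thesis
  proof (rule that[of tree_measure])
    show "emeasure tree_measure UNIV = M_h h K"
      by (simp only: emeasure_tree_measure_UNIV ennreal_weight root)
    show "AE z in tree_measure. z \<in> K" using AE_tree_measure by (simp only: root)
  qed (simp_all add: finite_measure_tree_measure emeasure_tree_measure_cball_le)
qed

section \<open>Potentials of measures with polynomial growth\<close>

lemma nn_integral_le_layers:
  fixes c m :: "nat \<Rightarrow> real"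
  assumes layer_sets: "\<And>j. B j \<in> sets M"
    and layer_mass: "\<And>j. emeasure M (B j) \<le> ennreal (m j)"
    and layer_bound: "\<And>x. x \<in> space M \<Longrightarrow> u x \<noteq> 0 \<Longrightarrow> \<exists>j. x \<in> B j \<and> u x \<le> ennreal (c j)"
    and nonneg: "\<And>j. 0 \<le> c j" "\<And>j. 0 \<le> m j"
    and sums: "(\<lambda>j. c j * m j) sums T"
  shows "(\<integral>\<^sup>+x. u x \<partial>M) \<le> ennreal T"
proof -
  have "(\<integral>\<^sup>+x. u x \<partial>M) \<le> (\<integral>\<^sup>+x. (\<Sum>j. ennreal (c j) * indicator (B j) x) \<partial>M)"
  proof (rule nn_integral_mono)
    fix x assume x: "x \<in> space M"
    show "u x \<le> (\<Sum>j. ennreal (c j) * indicator (B j) x)"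
    proof (cases "u x = 0")
      case False
      then obtain j where "x \<in> B j" "u x \<le> ennreal (c j)" using layer_bound x by blast
      then have "u x \<le> (\<Sum>i\<in>{j}. ennreal (c i) * indicator (B i) x)" by simp
      also have "\<dots> \<le> (\<Sum>j. ennreal (c j) * indicator (B j) x)" by (intro sum_le_suminf) auto
      finally show ?thesis .
    qed simp
  qed
  also have "\<dots> = (\<Sum>j. ennreal (c j) * emeasure M (B j))"
    using layer_sets by (simp add: nn_integral_suminf nn_integral_cmult_indicator)
  also have "\<dots> \<le> (\<Sum>j. ennreal (c j * m j))"
    using layer_mass nonneg by (intro suminf_le) (auto simp: ennreal_mult intro!: mult_left_mono)
  also have "\<dots> = ennreal T"
    using sums nonneg by (intro suminf_ennreal_eq) auto
  finally show ?thesis .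
qed

lemma two_powr_less_1: "a < 0 \<Longrightarrow> 2 powr a < (1 :: real)"
  using powr_less_mono[of a 0 2] by simp

lemma geometric_powr_sums:
  fixes C q :: real
  assumes "q < 0"
  shows "(\<lambda>j. C * 2 powr (q * real j)) sums (C / (1 - 2 powr q))"
proof -
  have "(\<lambda>j. C * (2 powr q) ^ j) sums (C * (1 / (1 - 2 powr q)))"
    using two_powr_less_1[OF assms] by (intro sums_mult geometric_sums) simp
  then show ?thesis by (simp add: powr_power mult.commute)
qed

lemma dyadic_powr_mult:
  fixes a b d x y :: real
  assumes "0 < d"
  shows "(d * 2 powr x) powr a * (d * 2 powr y) powr b = d powr (a + b) * 2 powr (x * a + y * b)"
  using assms by (simp add: powr_mult powr_powr powr_add)

lemma dyadic_scale_below: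
  fixes a d :: real
  assumes "0 < a" "a \<le> d"
  obtains j where "d * 2 powr (- real (Suc j)) < a" "a \<le> d * 2 powr (- real j)"
proof -
  obtain j where "(1 / 2) ^ Suc j < a / d" "a / d \<le> (1 / 2) ^ j"
    using assms dyadic_scale[of "a / d"] by auto
  then show ?thesis
    using that[of j] assms by (simp add: powr_minus powr_realpow field_simps del: of_nat_Suc)
qed

lemma dyadic_scale_above:
  fixes a d :: real
  assumes "0 < d" "d \<le> a"
  obtains j where "d * 2 powr real j \<le> a" "a < d * 2 powr real (Suc j)"
proof -
  obtain j where "(1 / 2) ^ Suc j < d / a" "d / a \<le> (1 / 2) ^ j"
    using assms dyadic_scale[of "d / a"] by auto
  then show ?thesis
    using that[of j] assms by (simp add: powr_realpow field_simps del: of_nat_Suc)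
qed

lemma nn_integral_dist_powr_cball_le:
  fixes \<nu> :: "'a :: metric_space measure"
  assumes "sets \<nu> = sets borel" "0 \<le> \<tau>" "\<tau> < s" "0 \<le> C" "0 < d"
    and growth: "\<And>r. 0 < r \<Longrightarrow> r \<le> d \<Longrightarrow> emeasure \<nu> (cball z r) \<le> ennreal (C * r powr s)"
  shows "(\<integral>\<^sup>+\<zeta>\<in>cball z d. ennreal (dist z \<zeta> powr (- \<tau>)) \<partial>\<nu>)
    \<le> ennreal (C * (2 powr \<tau> / (1 - 2 powr (\<tau> - s))) * d powr (s - \<tau>))"
proof (rule nn_integral_le_layers)
  define \<rho> where "\<rho> j = d * 2 powr (- real j)" for j
  have \<rho>: "0 < \<rho> j" "\<rho> j \<le> d" for j
    using \<open>0 < d\<close> powr_mono[of "- real j" 0 2] by (auto simp: \<rho>_def mult_le_cancel_left1)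
  show "cball z (\<rho> j) \<in> sets \<nu>" for j using assms(1) by simp
  show "emeasure \<nu> (cball z (\<rho> j)) \<le> ennreal (C * \<rho> j powr s)" for j by (rule growth[OF \<rho>])
  show "0 \<le> \<rho> (Suc j) powr (- \<tau>)" "0 \<le> C * \<rho> j powr s" for j using \<open>0 \<le> C\<close> by simp_all
  show "\<exists>j. \<zeta> \<in> cball z (\<rho> j) \<and>
      ennreal (dist z \<zeta> powr (- \<tau>)) * indicator (cball z d) \<zeta> \<le> ennreal (\<rho> (Suc j) powr (- \<tau>))"
    if "ennreal (dist z \<zeta> powr (- \<tau>)) * indicator (cball z d) \<zeta> \<noteq> 0" for \<zeta>
  proof -
    have \<zeta>: "dist z \<zeta> \<le> d" "z \<noteq> \<zeta>" using that by (auto simp: indicator_def split: if_splits)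
    then obtain j where "\<rho> (Suc j) < dist z \<zeta>" "dist z \<zeta> \<le> \<rho> j"
      using dyadic_scale_below[of "dist z \<zeta>" d] by (auto simp: \<rho>_def)
    then show ?thesis
      using \<zeta> \<rho>(1)[of "Suc j"] \<open>0 \<le> \<tau>\<close> by (intro exI[of _ j]) (auto intro!: ennreal_leI powr_mono2')
  qed
  have layer_term: "\<rho> (Suc j) powr (- \<tau>) * (C * \<rho> j powr s)
      = C * 2 powr \<tau> * d powr (s - \<tau>) * 2 powr ((\<tau> - s) * real j)" for j
  proof -
    have "\<rho> (Suc j) powr (- \<tau>) * \<rho> j powr s = d powr (s - \<tau>) * 2 powr (\<tau> + (\<tau> - s) * real j)"
      using \<open>0 < d\<close> by (simp add: \<rho>_def dyadic_powr_mult algebra_simps)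
    then show ?thesis by (simp add: powr_add)
  qed
  show "(\<lambda>j. \<rho> (Suc j) powr (- \<tau>) * (C * \<rho> j powr s))
      sums (C * (2 powr \<tau> / (1 - 2 powr (\<tau> - s))) * d powr (s - \<tau>))"
    unfolding layer_term
    using geometric_powr_sums[of "\<tau> - s" "C * 2 powr \<tau> * d powr (s - \<tau>)"] \<open>\<tau> < s\<close> by simp
qed

lemma nn_integral_dist_powr_shell_le:
  fixes \<nu> :: "'a :: metric_space measure"
  assumes "sets \<nu> = sets borel" "0 \<le> s" "s < \<tau>" "0 \<le> C" "0 < d" "0 < R"
    and growth: "\<And>r. 0 < r \<Longrightarrow> r \<le> R \<Longrightarrow> emeasure \<nu> (cball z r) \<le> ennreal (C * r powr s)"
  shows "(\<integral>\<^sup>+\<zeta>\<in>cball z R - cball z d. ennreal (dist z \<zeta> powr (- \<tau>)) \<partial>\<nu>)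
    \<le> ennreal (C * (2 powr s / (1 - 2 powr (s - \<tau>))) * d powr (s - \<tau>))"
proof (rule nn_integral_le_layers)
  define \<rho> where "\<rho> j = d * 2 powr real j" for j
  have \<rho>_pos: "0 < \<rho> j" for j using \<open>0 < d\<close> by (simp add: \<rho>_def)
  show "cball z (\<rho> (Suc j)) \<inter> cball z R \<in> sets \<nu>" for j using assms(1) by simp
  show "emeasure \<nu> (cball z (\<rho> (Suc j)) \<inter> cball z R) \<le> ennreal (C * \<rho> (Suc j) powr s)" for j
  proof -
    have "cball z (\<rho> (Suc j)) \<inter> cball z R = cball z (min (\<rho> (Suc j)) R)" by auto
    then have "emeasure \<nu> (cball z (\<rho> (Suc j)) \<inter> cball z R)
        \<le> ennreal (C * min (\<rho> (Suc j)) R powr s)"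
      using growth[of "min (\<rho> (Suc j)) R"] \<rho>_pos[of "Suc j"] \<open>0 < R\<close> by simp
    also have "\<dots> \<le> ennreal (C * \<rho> (Suc j) powr s)"
      using \<rho>_pos[of "Suc j"] \<open>0 < R\<close> \<open>0 \<le> C\<close> \<open>0 \<le> s\<close>
      by (intro ennreal_leI mult_left_mono powr_mono2) auto
    finally show ?thesis .
  qed
  show "0 \<le> \<rho> j powr (- \<tau>)" "0 \<le> C * \<rho> (Suc j) powr s" for j using \<open>0 \<le> C\<close> by simp_all
  show "\<exists>j. \<zeta> \<in> cball z (\<rho> (Suc j)) \<inter> cball z R \<and>
      ennreal (dist z \<zeta> powr (- \<tau>)) * indicator (cball z R - cball z d) \<zeta>
        \<le> ennreal (\<rho> j powr (- \<tau>))"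
    if "ennreal (dist z \<zeta> powr (- \<tau>)) * indicator (cball z R - cball z d) \<zeta> \<noteq> 0" for \<zeta>
  proof -
    have \<zeta>: "dist z \<zeta> \<le> R" "d < dist z \<zeta>" using that by (auto simp: indicator_def split: if_splits)
    then obtain j where "\<rho> j \<le> dist z \<zeta>" "dist z \<zeta> < \<rho> (Suc j)"
      using dyadic_scale_above[of d "dist z \<zeta>"] \<open>0 < d\<close> by (auto simp: \<rho>_def)
    then show ?thesis
      using \<zeta> \<rho>_pos[of j] \<open>0 \<le> s\<close> \<open>s < \<tau>\<close>
      by (intro exI[of _ j]) (auto intro!: ennreal_leI powr_mono2')
  qed
  have layer_term: "\<rho> j powr (- \<tau>) * (C * \<rho> (Suc j) powr s)
      = C * 2 powr s * d powr (s - \<tau>) * 2 powr ((s - \<tau>) * real j)" for j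
  proof -
    have "\<rho> j powr (- \<tau>) * \<rho> (Suc j) powr s = d powr (s - \<tau>) * 2 powr (s + (s - \<tau>) * real j)"
      using \<open>0 < d\<close> by (simp add: \<rho>_def dyadic_powr_mult algebra_simps)
    then show ?thesis by (simp add: powr_add)
  qed
  show "(\<lambda>j. \<rho> j powr (- \<tau>) * (C * \<rho> (Suc j) powr s))
      sums (C * (2 powr s / (1 - 2 powr (s - \<tau>))) * d powr (s - \<tau>))"
    unfolding layer_term
    using geometric_powr_sums[of "s - \<tau>" "C * 2 powr s * d powr (s - \<tau>)"] \<open>s < \<tau>\<close> by simp
qed

section \<open>Cauchy transforms of measures with small growth\<close>

definition cauchy_transform :: "complex measure \<Rightarrow> (complex \<Rightarrow> complex) \<Rightarrow> complex \<Rightarrow> complex" where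
  "cauchy_transform \<nu> \<phi> z = (LINT \<zeta>|\<nu>. \<phi> \<zeta> / (\<zeta> - z))"

definition diff_kernel :: "real \<Rightarrow> real \<Rightarrow> real" where
  "diff_kernel d a = (if a \<le> d then 2 / a else d / a\<^sup>2)"

lemma diff_kernel_nonneg: "0 \<le> d \<Longrightarrow> 0 \<le> a \<Longrightarrow> 0 \<le> diff_kernel d a"
  by (simp add: diff_kernel_def)

lemma ennreal_diff_kernel_le:
  fixes z \<zeta> :: "'a :: real_normed_vector"
  assumes "0 < d" "0 < \<rho>"
  shows "ennreal (diff_kernel d (norm (\<zeta> - z)))
    \<le> ennreal 2 * (ennreal (1 / norm (\<zeta> - z)) * indicator (cball z d) \<zeta>)
      + ennreal d * (ennreal (1 / (norm (\<zeta> - z))\<^sup>2) * indicator (cball z \<rho> - cball z d) \<zeta>)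
      + ennreal (d / \<rho>\<^sup>2)"
proof -
  define a where "a = norm (\<zeta> - z)"
  have "0 \<le> a" and dist_eq: "dist z \<zeta> = a"
    by (simp_all add: a_def dist_norm norm_minus_commute)
  consider "a \<le> d" | "d < a" "a \<le> \<rho>" | "d < a" "\<rho> < a" by linarith
  then show ?thesis
  proof cases
    case 1
    then have "ennreal (diff_kernel d a) = ennreal (2 * (1 / a))" by (simp add: diff_kernel_def)
    also have "\<dots> = ennreal 2 * ennreal (1 / a)" using \<open>0 \<le> a\<close> by (intro ennreal_mult) auto
    finally show ?thesis using 1 by (simp add: dist_eq add.assoc flip: a_def)
  next
    case 2
    then have "ennreal (diff_kernel d a) = ennreal (d * (1 / a\<^sup>2))" by (simp add: diff_kernel_def)
    also have "\<dots> = ennreal d * ennreal (1 / a\<^sup>2)" using assms(1) by (intro ennreal_mult) auto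
    finally show ?thesis using 2 by (simp add: dist_eq flip: a_def)
  next
    case 3
    then have "diff_kernel d a \<le> d / \<rho>\<^sup>2"
      using assms by (auto simp: diff_kernel_def intro!: divide_left_mono power_mono)
    then show ?thesis by (auto simp: a_def intro!: add_increasing ennreal_leI)
  qed
qed

lemma norm_diff_reciprocals_le:
  fixes x y :: "'a :: real_normed_field"
  assumes "x \<noteq> 0" "y \<noteq> 0"
  shows "norm (1 / x - 1 / y)
    \<le> diff_kernel (norm (x - y)) (norm x) + diff_kernel (norm (x - y)) (norm y)"
proof -
  have le_smaller: "norm (1 / u - 1 / v) \<le> diff_kernel (norm (u - v)) (norm u)"
    if "u \<noteq> 0" "v \<noteq> 0" "norm u \<le> norm v" for u v :: 'a
  proof -
    have "1 / u - 1 / v = (v - u) / (u * v)" using that by (simp add: field_simps)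
    then have "norm (1 / u - 1 / v) = norm (u - v) / (norm u * norm v)"
      by (simp add: norm_divide norm_mult norm_minus_commute)
    moreover have "norm (u - v) \<le> 2 * norm v" using norm_triangle_ineq4[of u v] that by simp
    then have "norm (u - v) / (norm u * norm v) \<le> 2 / norm u" using that by (simp add: field_simps)
    moreover have "norm (u - v) / (norm u * norm v) \<le> norm (u - v) / (norm u)\<^sup>2"
      unfolding power2_eq_square using that by (intro divide_left_mono mult_left_mono) auto
    ultimately show ?thesis by (simp add: diff_kernel_def)
  qed
  have "norm (1 / x - 1 / y) \<le> diff_kernel (norm (x - y)) (norm x) \<or>
      norm (1 / x - 1 / y) \<le> diff_kernel (norm (x - y)) (norm y)"
    using le_smaller[of x y] le_smaller[of y x] assms
    by (metis linear norm_minus_commute)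
  then show ?thesis
    using diff_kernel_nonneg[of "norm (x - y)" "norm x"]
      diff_kernel_nonneg[of "norm (x - y)" "norm y"]
    by auto
qed

lemma norm_integral_le_AE:
  fixes f :: "'a \<Rightarrow> 'b :: {banach, second_countable_topology}"
  assumes "integrable M g" "AE x in M. norm (f x) \<le> g x"
  shows "norm (LINT x|M. f x) \<le> (LINT x|M. g x)"
proof -
  have "AE x in M. 0 \<le> g x" using assms(2) by eventually_elim (metis norm_ge_zero order_trans)
  then have "(LINT x|M. norm (f x)) \<le> (LINT x|M. g x)" by (rule integral_mono_AE'[OF assms])
  with integral_norm_bound[of M f] show ?thesis by (rule order_trans)
qed

lemma norm_cauchy_transform_far_le:
  fixes \<nu> :: "complex measure"
  assumes "finite_measure \<nu>"
    and bounded: "AE \<zeta> in \<nu>. cmod (\<phi> \<zeta>) \<le> D" and close: "AE \<zeta> in \<nu>. cmod (\<zeta> - x0) \<le> R"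
    and "z \<noteq> x0" "2 * R \<le> cmod (z - x0)"
  shows "cmod (cauchy_transform \<nu> \<phi> z) \<le> 2 * D * measure \<nu> (space \<nu>) / cmod (z - x0)"
proof -
  interpret finite_measure \<nu> by fact
  have "cmod (cauchy_transform \<nu> \<phi> z) \<le> (LINT \<zeta>|\<nu>. 2 * D / cmod (z - x0))"
    unfolding cauchy_transform_def
  proof (rule norm_integral_le_AE)
    show "AE \<zeta> in \<nu>. cmod (\<phi> \<zeta> / (\<zeta> - z)) \<le> 2 * D / cmod (z - x0)"
      using bounded close
    proof eventually_elim
      case (elim \<zeta>)
      have "0 \<le> D" using elim(1) norm_ge_zero order_trans by blast
      have "cmod (z - x0) / 2 \<le> cmod (\<zeta> - z)"
        using elim(2) assms(5) norm_triangle_ineq4[of "\<zeta> - x0" "\<zeta> - z"] by simp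
      then have "cmod (\<phi> \<zeta>) / cmod (\<zeta> - z) \<le> D / (cmod (z - x0) / 2)"
        using elim(1) \<open>0 \<le> D\<close> \<open>z \<noteq> x0\<close> by (intro frac_le) auto
      then show ?case by (simp add: norm_divide mult.commute)
    qed
  qed simp
  then show ?thesis by (simp add: mult_ac)
qed

lemma powr_tendsto_0_at_right: "0 < a \<Longrightarrow> ((\<lambda>r :: real. r powr a) \<longlongrightarrow> 0) (at_right 0)"
proof (rule tendsto_zero_powrI[OF tendsto_ident_at tendsto_const])
  show "\<forall>\<^sub>F r :: real in at_right 0. 0 \<le> r"
    using eventually_at_right_less by (rule eventually_mono) simp
qed

lemma eventually_linear_le_powr:
  fixes M e \<alpha> :: real
  assumes "\<alpha> < 1" "0 < e"
  shows "\<forall>\<^sub>F d in at_right 0. M * d \<le> e * d powr \<alpha>"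
proof -
  have "((\<lambda>d. M * d powr (1 - \<alpha>)) \<longlongrightarrow> 0) (at_right 0)"
    using tendsto_mult_right_zero[OF powr_tendsto_0_at_right] assms(1) by simp
  then have "\<forall>\<^sub>F d in at_right 0. M * d powr (1 - \<alpha>) < e"
    using assms(2) by (rule order_tendstoD(2))
  then show ?thesis
    using eventually_at_right_less
  proof eventually_elim
    case (elim d)
    have "M * d = M * d powr (1 - \<alpha>) * d powr \<alpha>" using elim(2) by (simp flip: powr_add)
    also have "\<dots> \<le> e * d powr \<alpha>" using elim(1) by (intro mult_right_mono) auto
    finally show ?case .
  qed
qed

lemma lipI:
  assumes "0 \<le> \<alpha>" and bounded: "\<And>z. cmod (f z) \<le> B"
    and little: "\<And>e. 0 < e \<Longrightarrow> \<exists>\<delta>>0. \<forall>z w. cmod (z - w) < \<delta> \<longrightarrow>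
      cmod (f z - f w) \<le> e * cmod (z - w) powr \<alpha>"
  shows "f \<in> lip \<alpha>"
proof -
  obtain \<delta> where \<delta>: "0 < \<delta>" "\<And>z w. cmod (z - w) < \<delta> \<Longrightarrow> cmod (f z - f w) \<le> 1 * cmod (z - w) powr \<alpha>"
    using little[of 1] by auto
  have "0 \<le> B" using bounded[of 0] norm_ge_zero order_trans by blast
  have "cmod (f z - f w) \<le> (1 + 2 * B / \<delta> powr \<alpha>) * cmod (z - w) powr \<alpha>" for z w
  proof (cases "cmod (z - w) < \<delta>")
    case True
    have "cmod (f z - f w) \<le> 1 * cmod (z - w) powr \<alpha>" by (rule \<delta>(2)[OF True])
    also have "\<dots> \<le> (1 + 2 * B / \<delta> powr \<alpha>) * cmod (z - w) powr \<alpha>"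
      using \<open>0 \<le> B\<close> by (intro mult_right_mono) auto
    finally show ?thesis .
  next
    case False
    have "cmod (f z - f w) \<le> 2 * B"
      using norm_triangle_ineq4[of "f z" "f w"] bounded[of z] bounded[of w] by simp
    also have "\<dots> = 2 * B / \<delta> powr \<alpha> * \<delta> powr \<alpha>" using \<delta>(1) by simp
    also have "\<dots> \<le> (1 + 2 * B / \<delta> powr \<alpha>) * cmod (z - w) powr \<alpha>"
      using False \<delta>(1) \<open>0 \<le> B\<close> \<open>0 \<le> \<alpha>\<close> by (intro mult_mono powr_mono2) auto
    finally show ?thesis .
  qed
  moreover have "0 < 1 + 2 * B / \<delta> powr \<alpha>" using \<open>0 \<le> B\<close> by (intro add_pos_nonneg) auto
  ultimately have "f \<in> Lip \<alpha>" unfolding Lip_def using bounded by (auto simp: bounded_iff)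
  then show ?thesis using little by (simp add: lip_def)
qed

lemma isCont_lip:
  assumes "f \<in> lip \<alpha>" "0 < \<alpha>"
  shows "isCont f w"
proof -
  obtain k where k: "\<And>z w. cmod (f z - f w) \<le> k * cmod (z - w) powr \<alpha>"
    using assms(1) by (auto simp: lip_def Lip_def)
  have "((\<lambda>z. cmod (z - w)) \<longlongrightarrow> 0) (at w)"
    by (intro tendsto_norm_zero LIM_zero tendsto_ident_at)
  then have "((\<lambda>z. cmod (z - w) powr \<alpha>) \<longlongrightarrow> 0) (at w)"
    by (rule tendsto_zero_powrI) (use assms(2) in auto)
  then have "((\<lambda>z. k * cmod (z - w) powr \<alpha>) \<longlongrightarrow> 0) (at w)" by (rule tendsto_mult_right_zero)
  then have "((\<lambda>z. f z - f w) \<longlongrightarrow> 0) (at w)"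
    by (rule Lim_null_comparison[rotated]) (simp add: k)
  then show ?thesis unfolding isCont_def by (rule LIM_zero_cancel)
qed

definition near_const :: "real \<Rightarrow> real" where
  "near_const \<alpha> = 2 / (1 - 2 powr (- \<alpha>))"

definition far_const :: "real \<Rightarrow> real" where
  "far_const \<alpha> = 2 powr (1 + \<alpha>) / (1 - 2 powr (\<alpha> - 1))"

locale small_growth_measure = finite_measure \<nu> for \<nu> :: "complex measure" +
  fixes \<alpha> C :: real
  assumes sets_\<nu> [measurable_cong]: "sets \<nu> = sets borel"
    and \<alpha>: "0 < \<alpha>" "\<alpha> < 1"
    and C_nonneg: "0 \<le> C"
    and growth: "\<And>z r. 0 < r \<Longrightarrow> emeasure \<nu> (cball z r) \<le> ennreal (C * r powr (1 + \<alpha>))"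
    and small_growth: "\<And>\<epsilon>. 0 < \<epsilon> \<Longrightarrow> \<exists>\<rho>>0. \<forall>z r. 0 < r \<longrightarrow> r \<le> \<rho> \<longrightarrow>
      emeasure \<nu> (cball z r) \<le> ennreal (\<epsilon> * r powr (1 + \<alpha>))"
begin

lemma near_const_nonneg: "0 \<le> near_const \<alpha>"
  using two_powr_less_1[of "- \<alpha>"] \<alpha> by (simp add: near_const_def)

lemma far_const_nonneg: "0 \<le> far_const \<alpha>"
  using two_powr_less_1[of "\<alpha> - 1"] \<alpha> by (simp add: far_const_def)

lemma nn_integral_reciprocal_cball_le:
  assumes "0 < d" "0 \<le> \<epsilon>"
    and "\<And>r. 0 < r \<Longrightarrow> r \<le> d \<Longrightarrow> emeasure \<nu> (cball z r) \<le> ennreal (\<epsilon> * r powr (1 + \<alpha>))"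
  shows "(\<integral>\<^sup>+\<zeta>\<in>cball z d. ennreal (1 / cmod (\<zeta> - z)) \<partial>\<nu>) \<le> ennreal (\<epsilon> * near_const \<alpha> * d powr \<alpha>)"
proof -
  have "1 / cmod (\<zeta> - z) = dist z \<zeta> powr (- 1)" for \<zeta>
    by (simp add: powr_minus_divide dist_norm norm_minus_commute)
  then show ?thesis
    using nn_integral_dist_powr_cball_le[OF sets_\<nu>, of 1 "1 + \<alpha>" \<epsilon> d z] \<alpha>(1) assms
    by (simp add: near_const_def)
qed

lemma nn_integral_reciprocal_square_shell_le:
  assumes "0 < d" "0 < R" "0 \<le> \<epsilon>"
    and "\<And>r. 0 < r \<Longrightarrow> r \<le> R \<Longrightarrow> emeasure \<nu> (cball z r) \<le> ennreal (\<epsilon> * r powr (1 + \<alpha>))"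
  shows "(\<integral>\<^sup>+\<zeta>\<in>cball z R - cball z d. ennreal (1 / (cmod (\<zeta> - z))\<^sup>2) \<partial>\<nu>)
    \<le> ennreal (\<epsilon> * far_const \<alpha> * d powr (\<alpha> - 1))"
proof -
  have "1 / (cmod (\<zeta> - z))\<^sup>2 = dist z \<zeta> powr (- 2)" for \<zeta>
    by (simp add: powr_minus_divide dist_norm norm_minus_commute)
  then show ?thesis
    using nn_integral_dist_powr_shell_le[OF sets_\<nu>, of "1 + \<alpha>" 2 \<epsilon> d R z] \<alpha> assms
    by (simp add: far_const_def)
qed

lemma AE_neq: "AE \<zeta> in \<nu>. \<zeta> \<noteq> z"
proof -
  have "measure \<nu> {z} \<le> C * r powr (1 + \<alpha>)" if "0 < r" for r
  proof -
    have "emeasure \<nu> {z} \<le> emeasure \<nu> (cball z r)" using that sets_\<nu> by (intro emeasure_mono) auto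
    also have "\<dots> \<le> ennreal (C * r powr (1 + \<alpha>))" by (rule growth[OF that])
    finally show ?thesis using C_nonneg by (simp add: emeasure_eq_measure)
  qed
  then have "\<forall>\<^sub>F r in at_right 0. measure \<nu> {z} \<le> C * r powr (1 + \<alpha>)"
    by (auto simp: eventually_at_right_field intro!: exI[of _ 1])
  moreover have "((\<lambda>r. C * r powr (1 + \<alpha>)) \<longlongrightarrow> 0) (at_right 0)"
    using \<alpha> by (intro tendsto_mult_right_zero powr_tendsto_0_at_right) simp
  ultimately have "measure \<nu> {z} \<le> 0" by (intro tendsto_lowerbound) auto
  then have "emeasure \<nu> {z} = 0" by (simp add: emeasure_eq_measure measure_le_0_iff)
  then show ?thesis by (intro AE_I[of _ _ "{z}"]) (auto simp: sets_\<nu>)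
qed

lemma nn_integral_reciprocal_le:
  "(\<integral>\<^sup>+\<zeta>. ennreal (1 / cmod (\<zeta> - z)) \<partial>\<nu>) \<le> ennreal (C * near_const \<alpha> + measure \<nu> (space \<nu>))"
proof -
  have [measurable]: "cball z 1 \<in> sets borel" by simp
  have "(\<integral>\<^sup>+\<zeta>. ennreal (1 / cmod (\<zeta> - z)) \<partial>\<nu>)
    \<le> (\<integral>\<^sup>+\<zeta>. ennreal (1 / cmod (\<zeta> - z)) * indicator (cball z 1) \<zeta> + 1 \<partial>\<nu>)"
  proof (rule nn_integral_mono)
    fix \<zeta>
    show "ennreal (1 / cmod (\<zeta> - z)) \<le> ennreal (1 / cmod (\<zeta> - z)) * indicator (cball z 1) \<zeta> + 1"
    proof (cases "\<zeta> \<in> cball z 1")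
      case False
      then have "1 < cmod (\<zeta> - z)" by (simp add: dist_norm norm_minus_commute)
      then show ?thesis using False by (simp add: ennreal_leI divide_le_eq_1 flip: ennreal_1)
    qed simp
  qed
  also have "\<dots> = (\<integral>\<^sup>+\<zeta>\<in>cball z 1. ennreal (1 / cmod (\<zeta> - z)) \<partial>\<nu>) + emeasure \<nu> (space \<nu>)"
    by (subst nn_integral_add) auto
  also have "\<dots> \<le> ennreal (C * near_const \<alpha> * 1 powr \<alpha>) + ennreal (measure \<nu> (space \<nu>))"
    using nn_integral_reciprocal_cball_le[of 1 C z] C_nonneg growth
    by (intro add_mono) (auto simp: emeasure_eq_measure)
  finally show ?thesis using C_nonneg near_const_nonneg by (simp flip: ennreal_plus)
qed

lemma nn_integral_diff_kernel_le:
  assumes "0 < d" "d \<le> \<rho>" "0 \<le> \<epsilon>"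
    and "\<And>r. 0 < r \<Longrightarrow> r \<le> \<rho> \<Longrightarrow> emeasure \<nu> (cball z r) \<le> ennreal (\<epsilon> * r powr (1 + \<alpha>))"
  shows "(\<integral>\<^sup>+\<zeta>. ennreal (diff_kernel d (cmod (\<zeta> - z))) \<partial>\<nu>)
    \<le> ennreal (\<epsilon> * (2 * near_const \<alpha> + far_const \<alpha>) * d powr \<alpha> + d / \<rho>\<^sup>2 * measure \<nu> (space \<nu>))"
proof -
  define near where "near \<zeta> = ennreal (1 / cmod (\<zeta> - z)) * indicator (cball z d) \<zeta>" for \<zeta>
  define shell where
    "shell \<zeta> = ennreal (1 / (cmod (\<zeta> - z))\<^sup>2) * indicator (cball z \<rho> - cball z d) \<zeta>" for \<zeta>
  have [measurable]: "cball z r \<in> sets borel" for r by simp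
  have [measurable]: "near \<in> borel_measurable \<nu>" "shell \<in> borel_measurable \<nu>"
    unfolding near_def[abs_def] shell_def[abs_def] by measurable
  have "0 < \<rho>" using assms(1,2) by simp
  have "(\<integral>\<^sup>+\<zeta>. ennreal (diff_kernel d (cmod (\<zeta> - z))) \<partial>\<nu>)
      \<le> (\<integral>\<^sup>+\<zeta>. ennreal 2 * near \<zeta> + ennreal d * shell \<zeta> + ennreal (d / \<rho>\<^sup>2) \<partial>\<nu>)"
    unfolding near_def shell_def using assms(1,2)
    by (intro nn_integral_mono ennreal_diff_kernel_le) auto
  also have "\<dots> = ennreal 2 * (\<integral>\<^sup>+\<zeta>. near \<zeta> \<partial>\<nu>) + ennreal d * (\<integral>\<^sup>+\<zeta>. shell \<zeta> \<partial>\<nu>)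
      + ennreal (d / \<rho>\<^sup>2) * ennreal (measure \<nu> (space \<nu>))"
    by (simp add: nn_integral_add nn_integral_cmult emeasure_eq_measure)
  also have "\<dots> \<le> ennreal 2 * ennreal (\<epsilon> * near_const \<alpha> * d powr \<alpha>)
      + ennreal d * ennreal (\<epsilon> * far_const \<alpha> * d powr (\<alpha> - 1))
      + ennreal (d / \<rho>\<^sup>2) * ennreal (measure \<nu> (space \<nu>))"
    unfolding near_def shell_def using assms \<open>0 < \<rho>\<close>
    by (intro add_mono mult_left_mono order_refl nn_integral_reciprocal_cball_le
        nn_integral_reciprocal_square_shell_le) auto
  also have "\<dots> = ennreal (2 * (\<epsilon> * near_const \<alpha> * d powr \<alpha>)
      + d * (\<epsilon> * far_const \<alpha> * d powr (\<alpha> - 1)) + d / \<rho>\<^sup>2 * measure \<nu> (space \<nu>))"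
    using assms(1-3) near_const_nonneg far_const_nonneg
    by (simp only: ennreal_mult[symmetric] ennreal_plus[symmetric] add_nonneg_nonneg
        mult_nonneg_nonneg divide_nonneg_nonneg powr_ge_zero measure_nonneg zero_le_power2
        zero_le_numeral less_imp_le)
  also have "d * (\<epsilon> * far_const \<alpha> * d powr (\<alpha> - 1)) = \<epsilon> * far_const \<alpha> * d powr \<alpha>"
    using assms(1) by (simp add: powr_diff)
  finally show ?thesis by (simp add: algebra_simps)
qed

lemma nn_integral_cauchy_kernel_le:
  assumes [measurable]: "\<phi> \<in> borel_measurable borel"
    and bounded: "AE \<zeta> in \<nu>. cmod (\<phi> \<zeta>) \<le> D" and "0 \<le> D"
  shows "(\<integral>\<^sup>+\<zeta>. ennreal (cmod (\<phi> \<zeta> / (\<zeta> - z))) \<partial>\<nu>)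
    \<le> ennreal (D * (C * near_const \<alpha> + measure \<nu> (space \<nu>)))"
proof -
  have "(\<integral>\<^sup>+\<zeta>. ennreal (cmod (\<phi> \<zeta> / (\<zeta> - z))) \<partial>\<nu>)
      \<le> (\<integral>\<^sup>+\<zeta>. ennreal D * ennreal (1 / cmod (\<zeta> - z)) \<partial>\<nu>)"
  proof (rule nn_integral_mono_AE, use bounded in eventually_elim)
    case (elim \<zeta>)
    then have "cmod (\<phi> \<zeta> / (\<zeta> - z)) \<le> D * (1 / cmod (\<zeta> - z))"
      by (simp add: norm_divide divide_right_mono)
    then show ?case using \<open>0 \<le> D\<close> by (simp add: ennreal_leI flip: ennreal_mult)
  qed
  also have "\<dots> = ennreal D * (\<integral>\<^sup>+\<zeta>. ennreal (1 / cmod (\<zeta> - z)) \<partial>\<nu>)"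
    by (rule nn_integral_cmult) measurable
  also have "\<dots> \<le> ennreal D * ennreal (C * near_const \<alpha> + measure \<nu> (space \<nu>))"
    by (intro mult_left_mono nn_integral_reciprocal_le) simp
  finally show ?thesis using \<open>0 \<le> D\<close> C_nonneg near_const_nonneg by (simp add: ennreal_mult)
qed

lemma integrable_cauchy_kernel:
  assumes [measurable]: "\<phi> \<in> borel_measurable borel" and "AE \<zeta> in \<nu>. cmod (\<phi> \<zeta>) \<le> D" "0 \<le> D"
  shows "integrable \<nu> (\<lambda>\<zeta>. \<phi> \<zeta> / (\<zeta> - z))"
proof (rule integrableI_bounded)
  show "(\<integral>\<^sup>+\<zeta>. ennreal (cmod (\<phi> \<zeta> / (\<zeta> - z))) \<partial>\<nu>) < \<infinity>"
    using nn_integral_cauchy_kernel_le[OF assms, of z] by (rule le_less_trans) simp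
qed measurable

lemma norm_cauchy_transform_le:
  assumes "\<phi> \<in> borel_measurable borel" "AE \<zeta> in \<nu>. cmod (\<phi> \<zeta>) \<le> D" "0 \<le> D"
  shows "cmod (cauchy_transform \<nu> \<phi> z) \<le> D * (C * near_const \<alpha> + measure \<nu> (space \<nu>))"
proof -
  have "ennreal (cmod (cauchy_transform \<nu> \<phi> z)) \<le> (\<integral>\<^sup>+\<zeta>. ennreal (cmod (\<phi> \<zeta> / (\<zeta> - z))) \<partial>\<nu>)"
    unfolding cauchy_transform_def
    by (rule integral_norm_bound_ennreal[OF integrable_cauchy_kernel[OF assms]])
  also have "\<dots> \<le> ennreal (D * (C * near_const \<alpha> + measure \<nu> (space \<nu>)))"
    by (rule nn_integral_cauchy_kernel_le[OF assms])
  finally show ?thesis using assms(3) C_nonneg near_const_nonneg by simp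
qed

lemma norm_cauchy_transform_diff_le:
  assumes [measurable]: "\<phi> \<in> borel_measurable borel"
    and bounded: "AE \<zeta> in \<nu>. cmod (\<phi> \<zeta>) \<le> D" and "0 \<le> D"
    and "z \<noteq> w" "cmod (z - w) \<le> \<rho>" "0 \<le> \<epsilon>"
    and growth_\<epsilon>: "\<And>z r. 0 < r \<Longrightarrow> r \<le> \<rho> \<Longrightarrow> emeasure \<nu> (cball z r) \<le> ennreal (\<epsilon> * r powr (1 + \<alpha>))"
  shows "cmod (cauchy_transform \<nu> \<phi> z - cauchy_transform \<nu> \<phi> w)
    \<le> 2 * D * (\<epsilon> * (2 * near_const \<alpha> + far_const \<alpha>) * cmod (z - w) powr \<alpha>
        + cmod (z - w) / \<rho>\<^sup>2 * measure \<nu> (space \<nu>))" (is "_ \<le> 2 * D * ?I")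
proof -
  note kernel_integrable = integrable_cauchy_kernel[OF assms(1-3)]
  let ?k = "\<lambda>v \<zeta>. ennreal (diff_kernel (cmod (z - w)) (cmod (\<zeta> - v)))"
  have [measurable]: "?k v \<in> borel_measurable \<nu>" for v unfolding diff_kernel_def by measurable
  have "0 \<le> ?I" using near_const_nonneg far_const_nonneg assms(6) by simp
  have "ennreal (cmod (cauchy_transform \<nu> \<phi> z - cauchy_transform \<nu> \<phi> w))
      = ennreal (cmod (LINT \<zeta>|\<nu>. \<phi> \<zeta> / (\<zeta> - z) - \<phi> \<zeta> / (\<zeta> - w)))"
    unfolding cauchy_transform_def
    by (subst Bochner_Integration.integral_diff) (simp_all add: kernel_integrable)
  also have "\<dots> \<le> (\<integral>\<^sup>+\<zeta>. ennreal (cmod (\<phi> \<zeta> / (\<zeta> - z) - \<phi> \<zeta> / (\<zeta> - w))) \<partial>\<nu>)"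
    by (intro integral_norm_bound_ennreal Bochner_Integration.integrable_diff kernel_integrable)
  also have "\<dots> \<le> (\<integral>\<^sup>+\<zeta>. ennreal D * (?k z \<zeta> + ?k w \<zeta>) \<partial>\<nu>)"
  proof (rule nn_integral_mono_AE, use bounded AE_neq[of z] AE_neq[of w] in eventually_elim)
    case (elim \<zeta>)
    have "cmod (\<phi> \<zeta> / (\<zeta> - z) - \<phi> \<zeta> / (\<zeta> - w)) = cmod (\<phi> \<zeta>) * cmod (1 / (\<zeta> - z) - 1 / (\<zeta> - w))"
      by (simp add: right_diff_distrib flip: norm_mult)
    also have "\<dots> \<le> D * (diff_kernel (cmod (z - w)) (cmod (\<zeta> - z))
        + diff_kernel (cmod (z - w)) (cmod (\<zeta> - w)))"
      using norm_diff_reciprocals_le[of "\<zeta> - z" "\<zeta> - w"] elim \<open>0 \<le> D\<close>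
      by (intro mult_mono) (auto simp: norm_minus_commute)
    finally show ?case using \<open>0 \<le> D\<close>
      by (simp add: diff_kernel_nonneg ennreal_leI flip: ennreal_plus ennreal_mult)
  qed
  also have "\<dots> = ennreal D * ((\<integral>\<^sup>+\<zeta>. ?k z \<zeta> \<partial>\<nu>) + (\<integral>\<^sup>+\<zeta>. ?k w \<zeta> \<partial>\<nu>))"
    by (simp add: nn_integral_add nn_integral_cmult)
  also have "\<dots> \<le> ennreal D * (ennreal ?I + ennreal ?I)"
    using assms(4-6) growth_\<epsilon> by (intro mult_left_mono add_mono nn_integral_diff_kernel_le) auto
  also have "ennreal ?I + ennreal ?I = ennreal (2 * ?I)"
    by (subst ennreal_plus[symmetric]) (use \<open>0 \<le> ?I\<close> in \<open>simp_all only: mult_2\<close>)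
  also have "ennreal D * \<dots> = ennreal (2 * D * ?I)"
    using \<open>0 \<le> D\<close> \<open>0 \<le> ?I\<close> by (subst ennreal_mult[symmetric]) auto
  finally show ?thesis using \<open>0 \<le> D\<close> \<open>0 \<le> ?I\<close> by (subst (asm) ennreal_le_iff) auto
qed

lemma cauchy_transform_in_lip:
  assumes "\<phi> \<in> borel_measurable borel" "AE \<zeta> in \<nu>. cmod (\<phi> \<zeta>) \<le> D" "0 \<le> D"
  shows "cauchy_transform \<nu> \<phi> \<in> lip \<alpha>"
proof (rule lipI[OF _ norm_cauchy_transform_le[OF assms]])
  fix e :: real assume "0 < e"
  let ?f = "cauchy_transform \<nu> \<phi>"
  define A where "A = 2 * D * (2 * near_const \<alpha> + far_const \<alpha>)"
  have "0 \<le> A" using assms(3) near_const_nonneg far_const_nonneg by (simp add: A_def)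
  define \<epsilon> where "\<epsilon> = e / (2 * (A + 1))"
  have "0 < \<epsilon>" "A * \<epsilon> \<le> e / 2" using \<open>0 < e\<close> \<open>0 \<le> A\<close> by (auto simp: \<epsilon>_def field_simps)
  obtain \<rho> where \<rho>: "0 < \<rho>"
    "\<And>z r. 0 < r \<Longrightarrow> r \<le> \<rho> \<Longrightarrow> emeasure \<nu> (cball z r) \<le> ennreal (\<epsilon> * r powr (1 + \<alpha>))"
    using small_growth[OF \<open>0 < \<epsilon>\<close>] by blast
  define M where "M = 2 * D * measure \<nu> (space \<nu>) / \<rho>\<^sup>2"
  obtain \<delta> where \<delta>: "0 < \<delta>" "\<And>d. 0 < d \<Longrightarrow> d < \<delta> \<Longrightarrow> M * d \<le> e / 2 * d powr \<alpha>"
    using eventually_linear_le_powr[OF \<alpha>(2), of "e / 2" M] \<open>0 < e\<close>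
    unfolding eventually_at_right_field by auto
  have "cmod (?f z - ?f w) \<le> e * cmod (z - w) powr \<alpha>" if "cmod (z - w) < min \<delta> \<rho>" for z w
  proof (cases "z = w")
    case False
    let ?d = "cmod (z - w)"
    have "cmod (?f z - ?f w) \<le> A * \<epsilon> * ?d powr \<alpha> + M * ?d"
      using norm_cauchy_transform_diff_le[OF assms False _ _ \<rho>(2)] that \<open>0 < \<epsilon>\<close>
      by (simp add: A_def M_def algebra_simps)
    also have "\<dots> \<le> e / 2 * ?d powr \<alpha> + e / 2 * ?d powr \<alpha>"
      using \<open>A * \<epsilon> \<le> e / 2\<close> \<delta>(2)[of ?d] that False by (intro add_mono mult_right_mono) auto
    finally show ?thesis by simp
  qed simp
  then show "\<exists>\<delta>>0. \<forall>z w. cmod (z - w) < \<delta> \<longrightarrow> cmod (?f z - ?f w) \<le> e * cmod (z - w) powr \<alpha>"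
    using \<delta>(1) \<rho>(1) by (intro exI[of _ "min \<delta> \<rho>"]) auto
qed (use \<alpha> in simp)

lemma cauchy_transform_difference_quotient:
  assumes [measurable]: "\<phi> \<in> borel_measurable borel" and "AE \<zeta> in \<nu>. cmod (\<phi> \<zeta>) \<le> D" "0 \<le> D" "z \<noteq> w"
  shows "(cauchy_transform \<nu> \<phi> z - cauchy_transform \<nu> \<phi> w) / (z - w)
    = cauchy_transform \<nu> (\<lambda>\<zeta>. \<phi> \<zeta> / (\<zeta> - w)) z"
proof -
  have "cauchy_transform \<nu> \<phi> z - cauchy_transform \<nu> \<phi> w = (LINT \<zeta>|\<nu>. \<phi> \<zeta> / (\<zeta> - z) - \<phi> \<zeta> / (\<zeta> - w))"
    unfolding cauchy_transform_def
    by (subst Bochner_Integration.integral_diff)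
      (simp_all add: integrable_cauchy_kernel[OF assms(1-3)])
  also have "\<dots> = (LINT \<zeta>|\<nu>. (z - w) * (\<phi> \<zeta> / (\<zeta> - w) / (\<zeta> - z)))"
  proof (rule integral_cong_AE)
    show "AE \<zeta> in \<nu>. \<phi> \<zeta> / (\<zeta> - z) - \<phi> \<zeta> / (\<zeta> - w) = (z - w) * (\<phi> \<zeta> / (\<zeta> - w) / (\<zeta> - z))"
      using AE_neq[of z] AE_neq[of w] by eventually_elim (simp add: field_simps)
  qed measurable
  also have "\<dots> = (z - w) * cauchy_transform \<nu> (\<lambda>\<zeta>. \<phi> \<zeta> / (\<zeta> - w)) z"
    unfolding cauchy_transform_def by (rule integral_mult_right_zero)
  finally show ?thesis using assms(4) by simp
qed

text \<open>The difference quotients at a point of \<open>U\<close> are values of a single Cauchy transform, which is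
  continuous because it belongs to \<open>lip \<alpha>\<close>.\<close>

lemma cauchy_transform_analytic_on:
  assumes [measurable]: "\<phi> \<in> borel_measurable borel" and bounded: "AE \<zeta> in \<nu>. cmod (\<phi> \<zeta>) \<le> D"
    and "0 \<le> D" "open U" and outside: "AE \<zeta> in \<nu>. \<zeta> \<notin> U"
  shows "cauchy_transform \<nu> \<phi> analytic_on U"
proof -
  have "cauchy_transform \<nu> \<phi> field_differentiable at w" if "w \<in> U" for w
  proof -
    let ?q = "cauchy_transform \<nu> (\<lambda>\<zeta>. \<phi> \<zeta> / (\<zeta> - w))"
    obtain e where e: "0 < e" "ball w e \<subseteq> U" by (rule openE[OF \<open>open U\<close> \<open>w \<in> U\<close>])
    have "AE \<zeta> in \<nu>. cmod (\<phi> \<zeta> / (\<zeta> - w)) \<le> D / e"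
      using bounded outside
    proof eventually_elim
      case (elim \<zeta>)
      then have "\<zeta> \<notin> ball w e" using e(2) by blast
      then have "e \<le> cmod (\<zeta> - w)" by (simp add: dist_norm norm_minus_commute)
      then show ?case unfolding norm_divide using elim(1) e(1) \<open>0 \<le> D\<close> by (intro frac_le) auto
    qed
    then have "?q \<in> lip \<alpha>" by (rule cauchy_transform_in_lip[rotated]) (use \<open>0 \<le> D\<close> e(1) in auto)
    then have "(?q \<longlongrightarrow> ?q w) (at w)" using isCont_lip[OF _ \<alpha>(1)] by (simp add: isCont_def)
    then have "((\<lambda>z. (cauchy_transform \<nu> \<phi> z - cauchy_transform \<nu> \<phi> w) / (z - w)) \<longlongrightarrow> ?q w) (at w)"
      by (rule Lim_transform_eventually)
        (simp add: eventually_at_filter cauchy_transform_difference_quotient[OF assms(1-3)])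
    then show ?thesis unfolding field_differentiable_def has_field_derivative_iff by blast
  qed
  then show ?thesis
    using \<open>open U\<close> by (simp add: analytic_on_open holomorphic_on_def field_differentiable_at_within)
qed

lemma cauchy_transform_in_A_alpha:
  assumes "\<phi> \<in> borel_measurable borel" "AE \<zeta> in \<nu>. cmod (\<phi> \<zeta>) \<le> D" "0 \<le> D"
    and "open U" "AE \<zeta> in \<nu>. \<zeta> \<notin> U"
  shows "cauchy_transform \<nu> \<phi> \<in> A_alpha \<alpha> U"
  using cauchy_transform_in_lip[OF assms(1-3)] cauchy_transform_analytic_on[OF assms]
  by (simp add: A_alpha_def)

lemma measure_le_of_close:
  assumes "0 < R" "R \<le> 1" and close: "AE \<zeta> in \<nu>. cmod (\<zeta> - x0) \<le> R"
  shows "measure \<nu> (space \<nu>) \<le> C * R"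
proof -
  have "emeasure \<nu> (space \<nu>) \<le> emeasure \<nu> (cball x0 R)"
    using close
    by (intro emeasure_mono_AE)
      (auto simp: sets_\<nu> dist_norm norm_minus_commute elim: eventually_mono)
  also have "\<dots> \<le> ennreal (C * R powr (1 + \<alpha>))" by (rule growth[OF assms(1)])
  finally have "measure \<nu> (space \<nu>) \<le> C * R powr (1 + \<alpha>)"
    using C_nonneg by (simp add: emeasure_eq_measure)
  also have "\<dots> \<le> C * R powr 1" using C_nonneg assms \<alpha> by (intro mult_left_mono powr_mono') auto
  finally show ?thesis using assms(1) by simp
qed

lemma norm_cauchy_transform_decay:
  assumes \<phi>: "\<phi> \<in> borel_measurable borel" "AE \<zeta> in \<nu>. cmod (\<phi> \<zeta>) \<le> D" "0 \<le> D"
    and R: "0 < R" "R \<le> 1" and close: "AE \<zeta> in \<nu>. cmod (\<zeta> - x0) \<le> R" and "z \<noteq> x0"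
  shows "cmod (cauchy_transform \<nu> \<phi> z)
    \<le> 2 * D * C * (near_const \<alpha> + 1) * min 1 (R / cmod (z - x0))"
proof -
  define \<rho> where "\<rho> = cmod (z - x0)"
  have "0 < \<rho>" using \<open>z \<noteq> x0\<close> by (simp add: \<rho>_def)
  let ?B = "D * (C * (near_const \<alpha> + 1))"
  have "0 \<le> ?B" and C_le: "D * C \<le> ?B"
    using \<phi>(3) C_nonneg near_const_nonneg by (auto simp: distrib_left)
  have mass_le: "D * measure \<nu> (space \<nu>) \<le> D * (C * R)"
    by (intro mult_left_mono measure_le_of_close[OF R close] \<phi>(3))
  also have "D * (C * R) \<le> D * C" using \<phi>(3) C_nonneg R by (intro mult_left_mono mult_left_le) auto
  finally have uniform: "cmod (cauchy_transform \<nu> \<phi> z) \<le> ?B"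
    using norm_cauchy_transform_le[OF \<phi>, of z] by (simp add: distrib_left)
  have "cmod (cauchy_transform \<nu> \<phi> z) \<le> 2 * ?B * (R / \<rho>)"
  proof (cases "2 * R \<le> \<rho>")
    case True
    have "D * measure \<nu> (space \<nu>) \<le> ?B * R"
      using mass_le mult_right_mono[OF C_le, of R] R(1) by (simp add: mult.assoc)
    then have "2 * D * measure \<nu> (space \<nu>) / \<rho> \<le> 2 * ?B * (R / \<rho>)"
      using divide_right_mono[of "2 * (D * measure \<nu> (space \<nu>))" "2 * (?B * R)" \<rho>] \<open>0 < \<rho>\<close>
      by (simp add: mult.assoc)
    with norm_cauchy_transform_far_le[OF finite_measure_axioms \<phi>(2) close \<open>z \<noteq> x0\<close>] True
    show ?thesis unfolding \<rho>_def by linarith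
  next
    case False
    then have "1 \<le> 2 * (R / \<rho>)" using \<open>0 < \<rho>\<close> by (simp add: field_simps)
    from mult_left_mono[OF this \<open>0 \<le> ?B\<close>] uniform show ?thesis by (simp add: mult_ac)
  qed
  moreover have "cmod (cauchy_transform \<nu> \<phi> z) \<le> 2 * ?B * 1" using uniform \<open>0 \<le> ?B\<close> by linarith
  ultimately show ?thesis by (simp add: min_def \<rho>_def mult.assoc)
qed

end

lemma small_growth_measure_of_lower_gauge:
  assumes "0 < \<alpha>" "\<alpha> < 1" and gauge: "lower_gauge \<alpha> h" and pos: "0 < a" "0 < b"
    and "finite_measure \<nu>" and "sets \<nu> = sets borel"
    and growth: "\<And>z r. 0 < r \<Longrightarrow> emeasure \<nu> (cball z r) \<le> ennreal (a * h (b * r))"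
  shows "small_growth_measure \<nu> \<alpha> (a * b powr (1 + \<alpha>))"
proof -
  have growth_scaled: "emeasure \<nu> (cball z r) \<le> ennreal (\<epsilon> * (a * b powr (1 + \<alpha>)) * r powr (1 + \<alpha>))"
    if "0 < r" "h (b * r) \<le> \<epsilon> * (b * r) powr (1 + \<alpha>)" for z r \<epsilon>
  proof -
    have "a * h (b * r) \<le> \<epsilon> * (a * b powr (1 + \<alpha>)) * r powr (1 + \<alpha>)"
      using mult_left_mono[OF that(2), of a] that(1) pos by (simp add: powr_mult mult_ac)
    then show ?thesis using growth[OF that(1)] by (metis ennreal_leI order_trans)
  qed
  interpret finite_measure \<nu> by fact
  show ?thesis
  proof
    show "emeasure \<nu> (cball z r) \<le> ennreal (a * b powr (1 + \<alpha>) * r powr (1 + \<alpha>))" if "0 < r" for z r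
      using growth_scaled[OF that, of 1] gauge pos that by (simp add: lower_gauge_def)
  next
    fix \<epsilon> :: real assume "0 < \<epsilon>"
    let ?\<epsilon> = "\<epsilon> / (a * b powr (1 + \<alpha>))"
    have "\<forall>\<^sub>F r in at_right 0. h r / r powr (1 + \<alpha>) < ?\<epsilon>"
      using gauge pos \<open>0 < \<epsilon>\<close> by (intro order_tendstoD(2)) (auto simp: lower_gauge_def)
    then obtain \<delta> where \<delta>: "0 < \<delta>" "\<And>r. 0 < r \<Longrightarrow> r < \<delta> \<Longrightarrow> h r / r powr (1 + \<alpha>) < ?\<epsilon>"
      unfolding eventually_at_right_field by auto
    show "\<exists>\<rho>>0. \<forall>z r. 0 < r \<longrightarrow> r \<le> \<rho> \<longrightarrow> emeasure \<nu> (cball z r) \<le> ennreal (\<epsilon> * r powr (1 + \<alpha>))"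
    proof (intro exI[of _ "\<delta> / (2 * b)"] conjI allI impI)
      fix z r assume r: "0 < r" "r \<le> \<delta> / (2 * b)"
      then have "b * r < \<delta>" using \<delta>(1) pos(2) by (simp add: field_simps)
      then have "h (b * r) \<le> ?\<epsilon> * (b * r) powr (1 + \<alpha>)"
        using \<delta>(2)[of "b * r"] r(1) pos(2) by (simp add: pos_divide_less_eq)
      from growth_scaled[OF r(1) this, of z]
      show "emeasure \<nu> (cball z r) \<le> ennreal (\<epsilon> * r powr (1 + \<alpha>))" using pos by simp
    qed (use \<delta>(1) pos(2) in simp)
  qed (use assms in auto)
qed

section \<open>Test functions adapted to an annulus\<close>

definition phase :: "complex \<Rightarrow> nat \<Rightarrow> complex \<Rightarrow> complex" where
  "phase x0 k \<zeta> = sgn (\<zeta> - x0) ^ k"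

definition reciprocal_moment ::
  "complex measure \<Rightarrow> (complex \<Rightarrow> complex) \<Rightarrow> complex \<Rightarrow> nat \<Rightarrow> complex" where
  "reciprocal_moment M \<phi> x0 k = (LINT \<zeta>|M. \<phi> \<zeta> / (\<zeta> - x0) ^ k)"

definition test_function :: "complex measure \<Rightarrow> complex \<Rightarrow> nat \<Rightarrow> complex \<Rightarrow> complex" where
  "test_function \<nu> x0 t = cauchy_transform \<nu> (phase x0 (Suc t))"

text \<open>The part of \<open>test_function \<nu> x0 t z / (z - x0) ^ t\<close> that remains after its polar part at
  \<open>x0\<close> is removed.\<close>

definition regular_part :: "complex measure \<Rightarrow> complex \<Rightarrow> nat \<Rightarrow> complex \<Rightarrow> complex" where
  "regular_part \<nu> x0 t = cauchy_transform \<nu> (\<lambda>\<zeta>. phase x0 (Suc t) \<zeta> / (\<zeta> - x0) ^ t)"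

lemma borel_measurable_phase [measurable]: "phase x0 k \<in> borel_measurable borel"
  unfolding phase_def[abs_def] sgn_div_norm by measurable

lemma norm_phase_le_1: "cmod (phase x0 k \<zeta>) \<le> 1"
  unfolding phase_def norm_power by (rule power_le_one) (auto simp: norm_sgn)

lemma phase_divide_power: "phase x0 k \<zeta> / (\<zeta> - x0) ^ k = complex_of_real ((1 / cmod (\<zeta> - x0)) ^ k)"
proof -
  have "sgn (\<zeta> - x0) / (\<zeta> - x0) = complex_of_real (1 / cmod (\<zeta> - x0))"
    by (cases "\<zeta> = x0") (auto simp: sgn_eq)
  then show ?thesis unfolding phase_def power_divide[symmetric] by (simp only: of_real_power)
qed

lemma reciprocal_diff_divide_power:
  fixes a b :: "'a :: field"
  assumes "a \<noteq> 0" "b \<noteq> 0" "a \<noteq> b"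
  shows "1 / ((a - b) * b ^ t) = 1 / (a ^ t * (a - b)) + (\<Sum>j<t. 1 / (a ^ (t - j) * b ^ Suc j))"
proof (induction t)
  case 0
  then show ?case by simp
next
  case (Suc t)
  have "1 / ((a - b) * b ^ Suc t) = 1 / b * (1 / ((a - b) * b ^ t))" by simp
  also have "\<dots> = 1 / (b * (a ^ t * (a - b))) + (\<Sum>j<t. 1 / (a ^ (t - j) * b ^ Suc (Suc j)))"
    unfolding Suc by (simp add: distrib_left sum_distrib_left mult_ac)
  also have "1 / (b * (a ^ t * (a - b))) = 1 / a ^ t * (1 / (b * (a - b)))" by simp
  also have "1 / (b * (a - b)) = 1 / (a * (a - b)) + 1 / (a * b)"
    using assms by (simp add: divide_simps)
  also have "1 / a ^ t * \<dots> = 1 / (a ^ Suc t * (a - b)) + 1 / (a ^ Suc t * b)"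
    by (simp add: distrib_left mult_ac)
  finally show ?case by (subst sum.lessThan_Suc_shift) (simp add: add.assoc)
qed

locale annular_measure = small_growth_measure \<nu> \<alpha> C
  for \<nu> :: "complex measure" and \<alpha> C :: real +
  fixes x0 :: complex and U :: "complex set" and R :: real
  assumes open_U: "open U" and R: "0 < R" "R \<le> 1"
    and away: "AE \<zeta> in \<nu>. R / 2 \<le> cmod (\<zeta> - x0)"
    and close: "AE \<zeta> in \<nu>. cmod (\<zeta> - x0) \<le> R"
    and outside: "AE \<zeta> in \<nu>. \<zeta> \<notin> U"
begin

lemma norm_phase_divide_power_le:
  "AE \<zeta> in \<nu>. cmod (phase x0 k \<zeta> / (\<zeta> - x0) ^ i) \<le> (2 / R) ^ i"
  using away
proof eventually_elim
  case (elim \<zeta>)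
  have "cmod (phase x0 k \<zeta>) / cmod (\<zeta> - x0) ^ i \<le> 1 / (R / 2) ^ i"
    using norm_phase_le_1 elim R(1) by (intro frac_le power_mono) auto
  then show ?case by (simp add: norm_divide norm_power power_divide)
qed

lemma integrable_phase_divide_power: "integrable \<nu> (\<lambda>\<zeta>. phase x0 k \<zeta> / (\<zeta> - x0) ^ i)"
  by (rule integrable_const_bound[OF norm_phase_divide_power_le]) measurable

lemma norm_reciprocal_moment_phase_le:
  "cmod (reciprocal_moment \<nu> (phase x0 k) x0 i) \<le> (2 / R) ^ i * measure \<nu> (space \<nu>)"
  using norm_integral_le_AE[OF _ norm_phase_divide_power_le[of k i]]
  by (simp add: reciprocal_moment_def mult.commute)

lemma test_function_in_lip: "test_function \<nu> x0 t \<in> lip \<alpha>"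
  unfolding test_function_def
  by (rule cauchy_transform_in_lip[where D = 1]) (simp_all add: norm_phase_le_1)

lemma norm_test_function_le:
  "z \<noteq> x0 \<Longrightarrow> cmod (test_function \<nu> x0 t z) \<le> 2 * C * (near_const \<alpha> + 1) * min 1 (R / cmod (z - x0))"
  unfolding test_function_def
  using norm_cauchy_transform_decay[OF borel_measurable_phase _ _ R close, where D = 1]
  by (simp add: norm_phase_le_1)

lemma regular_part_in_A_alpha: "regular_part \<nu> x0 t \<in> A_alpha \<alpha> U"
  unfolding regular_part_def
  by (rule cauchy_transform_in_A_alpha[OF _ norm_phase_divide_power_le _ open_U outside])
    (use R in auto)

lemma test_function_divide_power:
  assumes "z \<noteq> x0"
  shows "test_function \<nu> x0 t z / (z - x0) ^ t = regular_part \<nu> x0 t z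
    + (\<Sum>j<t. reciprocal_moment \<nu> (phase x0 (Suc t)) x0 (t - j) / (z - x0) ^ Suc j)"
proof -
  let ?\<theta> = "phase x0 (Suc t)"
  let ?polar = "\<lambda>\<zeta> j. ?\<theta> \<zeta> / (\<zeta> - x0) ^ (t - j) / (z - x0) ^ Suc j"
  have kernel_integrable: "integrable \<nu> (\<lambda>\<zeta>. ?\<theta> \<zeta> / (\<zeta> - x0) ^ t / (\<zeta> - z))"
    by (rule integrable_cauchy_kernel[OF _ norm_phase_divide_power_le]) (use R in auto)
  have polar_integrable: "integrable \<nu> (\<lambda>\<zeta>. ?polar \<zeta> j)" for j
    by (intro integrable_divide integrable_phase_divide_power)
  have "test_function \<nu> x0 t z / (z - x0) ^ t = (LINT \<zeta>|\<nu>. ?\<theta> \<zeta> / (\<zeta> - z) / (z - x0) ^ t)"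
    unfolding test_function_def cauchy_transform_def by (simp only: integral_divide_zero)
  also have "\<dots> = (LINT \<zeta>|\<nu>. ?\<theta> \<zeta> / (\<zeta> - x0) ^ t / (\<zeta> - z) + (\<Sum>j<t. ?polar \<zeta> j))"
  proof (rule integral_cong_AE)
    show "AE \<zeta> in \<nu>. ?\<theta> \<zeta> / (\<zeta> - z) / (z - x0) ^ t
        = ?\<theta> \<zeta> / (\<zeta> - x0) ^ t / (\<zeta> - z) + (\<Sum>j<t. ?polar \<zeta> j)"
      using AE_neq[of z] AE_neq[of x0]
    proof eventually_elim
      case (elim \<zeta>)
      then have "\<zeta> - x0 \<noteq> 0" "z - x0 \<noteq> 0" "\<zeta> - x0 \<noteq> z - x0" using assms by auto
      from reciprocal_diff_divide_power[OF this, of t]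
      have "?\<theta> \<zeta> * (1 / ((\<zeta> - z) * (z - x0) ^ t)) = ?\<theta> \<zeta> * (1 / ((\<zeta> - x0) ^ t * (\<zeta> - z))
          + (\<Sum>j<t. 1 / ((\<zeta> - x0) ^ (t - j) * (z - x0) ^ Suc j)))" by simp
      then show ?case by (simp add: distrib_left sum_distrib_left)
    qed
  qed measurable
  also have "\<dots> = regular_part \<nu> x0 t z + (\<Sum>j<t. LINT \<zeta>|\<nu>. ?polar \<zeta> j)"
    unfolding regular_part_def cauchy_transform_def
    by (simp only: Bochner_Integration.integral_add Bochner_Integration.integral_sum
        Bochner_Integration.integrable_sum kernel_integrable polar_integrable)
  finally show ?thesis by (simp only: reciprocal_moment_def integral_divide_zero)
qed

lemma Re_regular_part_center_ge:
  "(1 / R) ^ Suc t * measure \<nu> (space \<nu>) \<le> Re (regular_part \<nu> x0 t x0)"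
proof -
  have "regular_part \<nu> x0 t x0 = (LINT \<zeta>|\<nu>. complex_of_real ((1 / cmod (\<zeta> - x0)) ^ Suc t))"
    unfolding regular_part_def cauchy_transform_def phase_divide_power[symmetric]
    by (simp add: mult.commute)
  then have "Re (regular_part \<nu> x0 t x0) = (LINT \<zeta>|\<nu>. (1 / cmod (\<zeta> - x0)) ^ Suc t)"
    by (simp only: integral_complex_of_real Re_complex_of_real)
  moreover have "(LINT \<zeta>|\<nu>. (1 / R) ^ Suc t) \<le> (LINT \<zeta>|\<nu>. (1 / cmod (\<zeta> - x0)) ^ Suc t)"
  proof (rule integral_mono_AE)
    have "AE \<zeta> in \<nu>. norm ((1 / cmod (\<zeta> - x0)) ^ Suc t) \<le> (2 / R) ^ Suc t"
      using norm_phase_divide_power_le[of "Suc t" "Suc t"]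
      unfolding phase_divide_power by (simp only: norm_of_real real_norm_def)
    then show "integrable \<nu> (\<lambda>\<zeta>. (1 / cmod (\<zeta> - x0)) ^ Suc t)"
      by (rule integrable_const_bound) measurable
    show "AE \<zeta> in \<nu>. (1 / R) ^ Suc t \<le> (1 / cmod (\<zeta> - x0)) ^ Suc t"
      using close away
    proof eventually_elim
      case (elim \<zeta>)
      then show ?case using R(1) by (intro power_mono frac_le) auto
    qed
  qed simp
  ultimately show ?thesis by (simp add: mult.commute)
qed

end

lemma exists_annular_measure:
  assumes \<alpha>: "0 < \<alpha>" "\<alpha> < 1" and "open U"
  shows "\<exists>\<nu>. annular_measure \<nu> \<alpha> (49 * 8 powr (1 + \<alpha>)) x0 U ((1 / 2) ^ n) \<and>
    lower_content \<alpha> (annulus x0 n - U) \<le> ennreal (2 * measure \<nu> (space \<nu>))"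
proof -
  define K where "K = (cball x0 ((1 / 2) ^ n) - ball x0 ((1 / 2) ^ n / 2)) - U"
  have "compact K" unfolding K_def using \<open>open U\<close> by (intro compact_diff) auto
  have K: "(1 / 2) ^ n / 2 \<le> cmod (z - x0)" "cmod (z - x0) \<le> (1 / 2) ^ n" "z \<notin> U" if "z \<in> K" for z
    using that by (auto simp: K_def dist_norm norm_minus_commute)
  have "annulus x0 n - U \<subseteq> K"
    by (auto simp: annulus_def K_def dist_norm norm_minus_commute powr_diff powr_minus_divide
        powr_realpow power_one_over)
  moreover have "K \<subseteq> ball x0 2"
    using K(2) power_le_one[of "1 / 2 :: real" n] by (fastforce simp: dist_norm norm_minus_commute)
  ultimately have "lower_content \<alpha> (annulus x0 n - U) < top"
    by (intro lower_content_subset_ball_less_top[of _ x0 2]) auto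
  then obtain h where h: "lower_gauge \<alpha> h"
    "lower_content \<alpha> (annulus x0 n - U) \<le> 2 * M_h h (annulus x0 n - U)"
    by (rule lower_content_le_twice_M_h)
  obtain \<nu> where \<nu>: "sets \<nu> = sets borel" "finite_measure \<nu>" "emeasure \<nu> UNIV = M_h h K"
    "AE z in \<nu>. z \<in> K"
    "\<And>z r. 0 < r \<Longrightarrow> emeasure \<nu> (cball z r) \<le> ennreal (49 * h (8 * r))"
    using frostman[OF \<open>compact K\<close>, of h] h(1) unfolding lower_gauge_def by metis
  interpret small_growth_measure \<nu> \<alpha> "49 * 8 powr (1 + \<alpha>)"
    by (rule small_growth_measure_of_lower_gauge[OF \<alpha> h(1) _ _ \<nu>(2,1,5)]) auto
  have "annular_measure \<nu> \<alpha> (49 * 8 powr (1 + \<alpha>)) x0 U ((1 / 2) ^ n)"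
    by unfold_locales (use \<nu>(4) K \<open>open U\<close> in \<open>auto simp: power_le_one elim: eventually_mono\<close>)
  moreover have "lower_content \<alpha> (annulus x0 n - U) \<le> ennreal (2 * measure \<nu> (space \<nu>))"
  proof -
    have "lower_content \<alpha> (annulus x0 n - U) \<le> 2 * M_h h K"
      using h(2) mult_left_mono[OF M_h_mono[OF \<open>annulus x0 n - U \<subseteq> K\<close>, of h], of 2]
      by (auto intro: order_trans)
    also have "M_h h K = ennreal (measure \<nu> (space \<nu>))"
      using \<nu>(3) sets_eq_imp_space_eq[OF \<nu>(1)] by (simp add: emeasure_eq_measure)
    also have "2 * \<dots> = ennreal (2 * measure \<nu> (space \<nu>))" by (simp add: ennreal_mult)
    finally show ?thesis .
  qed
  ultimately show ?thesis by blast
qed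

section \<open>Weighted sums over dyadic scales\<close>

lemma sum_power_inj_le:
  fixes q :: real
  assumes "finite A" "inj_on f A" "0 \<le> q" "q < 1"
  shows "(\<Sum>n\<in>A. q ^ f n) \<le> 1 / (1 - q)"
proof -
  have "(\<Sum>n\<in>A. q ^ f n) = (\<Sum>k\<in>f ` A. q ^ k)" using assms(2) by (simp add: sum.reindex)
  also have "\<dots> \<le> (\<Sum>k. q ^ k)" using assms by (intro sum_le_suminf summable_geometric) auto
  also have "\<dots> = 1 / (1 - q)" using assms by (simp add: suminf_geometric)
  finally show ?thesis .
qed

definition dyadic_const :: "real \<Rightarrow> real" where
  "dyadic_const lam = 1 / (1 - 2 powr (- lam)) + 1 / (1 - 2 powr (lam - 1))"

lemma dyadic_weight_le_below:
  fixes lam y :: real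
  assumes "0 < lam" "int n \<le> k" "real_of_int k \<le> y"
  shows "2 powr (lam * real n) \<le> 2 powr (lam * y) * (2 powr (- lam)) ^ nat (k - int n)"
proof -
  have "lam * real_of_int k \<le> lam * y" using assms by (intro mult_left_mono) auto
  then have "2 powr (lam * real n) \<le> 2 powr (lam * y + - lam * (real_of_int k - real n))"
    by (simp add: algebra_simps)
  also have "\<dots> = 2 powr (lam * y) * (2 powr (- lam)) ^ nat (k - int n)"
    using assms(2) by (simp only: powr_add) (simp add: powr_power mult.commute)
  finally show ?thesis .
qed

lemma dyadic_weight_le_above:
  fixes lam y :: real
  assumes "lam < 1" "k < int n" "y \<le> real_of_int k + 1"
  shows "2 powr (lam * real n) * 2 powr (y - real n)
    \<le> 2 powr (lam * y) * (2 powr (lam - 1)) ^ nat (int n - k - 1)"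
proof -
  have "(1 - lam) * y \<le> (1 - lam) * (real_of_int k + 1)" using assms by (intro mult_left_mono) auto
  then have "2 powr (lam * real n + (y - real n))
      \<le> 2 powr (lam * y + (lam - 1) * (real n - real_of_int k - 1))"
    by (simp add: algebra_simps)
  also have "\<dots> = 2 powr (lam * y) * (2 powr (lam - 1)) ^ nat (int n - k - 1)"
    using assms(2) by (simp only: powr_add) (simp add: powr_power mult.commute)
  finally show ?thesis by (simp add: powr_add)
qed

lemma sum_dyadic_min_le:
  fixes lam \<rho> :: real
  assumes lam: "0 < lam" "lam < 1" and "0 < \<rho>" "finite A"
  shows "(\<Sum>n\<in>A. 2 powr (lam * real n) * min 1 ((1 / 2) ^ n / \<rho>))
    \<le> dyadic_const lam * \<rho> powr (- lam)"
proof -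
  let ?u = "\<lambda>n. 2 powr (lam * real n) * min 1 ((1 / 2) ^ n / \<rho>)"
  define y where "y = - log 2 \<rho>"
  define k where "k = \<lfloor>y\<rfloor>"
  have k: "real_of_int k \<le> y" "y \<le> real_of_int k + 1" by (auto simp: k_def)
  have \<rho>: "\<rho> = 2 powr (- y)" using \<open>0 < \<rho>\<close> by (simp add: y_def)
  then have \<rho>_powr: "\<rho> powr (- lam) = 2 powr (lam * y)" by (simp add: powr_powr mult.commute)
  define low where "low = {n\<in>A. int n \<le> k}"
  define high where "high = {n\<in>A. k < int n}"
  have "finite low" "finite high" using \<open>finite A\<close> by (auto simp: low_def high_def)
  have low_term: "?u n \<le> \<rho> powr (- lam) * (2 powr (- lam)) ^ nat (k - int n)" if "n \<in> low" for n
  proof -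
    have "?u n \<le> 2 powr (lam * real n) * 1" by (intro mult_left_mono) auto
    also have "\<dots> \<le> \<rho> powr (- lam) * (2 powr (- lam)) ^ nat (k - int n)"
      using dyadic_weight_le_below[OF lam(1) _ k(1), of n] that by (simp add: low_def \<rho>_powr)
    finally show ?thesis .
  qed
  have high_term: "?u n \<le> \<rho> powr (- lam) * (2 powr (lam - 1)) ^ nat (int n - k - 1)"
    if "n \<in> high" for n
  proof -
    have "?u n \<le> 2 powr (lam * real n) * ((1 / 2) ^ n / \<rho>)" by (intro mult_left_mono) auto
    also have "\<dots> = 2 powr (lam * real n) * 2 powr (y - real n)"
      by (simp add: \<rho> powr_diff powr_minus_divide powr_realpow power_one_over)
    also have "\<dots> \<le> \<rho> powr (- lam) * (2 powr (lam - 1)) ^ nat (int n - k - 1)"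
      using dyadic_weight_le_above[OF lam(2) _ k(2), of n] that by (simp add: high_def \<rho>_powr)
    finally show ?thesis .
  qed
  have "(\<Sum>n\<in>A. ?u n) = (\<Sum>n\<in>low. ?u n) + (\<Sum>n\<in>high. ?u n)"
    using \<open>finite A\<close>
    by (subst sum.union_disjoint[symmetric]) (auto simp: low_def high_def intro!: sum.cong)
  also have "\<dots> \<le> \<rho> powr (- lam) * (\<Sum>n\<in>low. (2 powr (- lam)) ^ nat (k - int n))
      + \<rho> powr (- lam) * (\<Sum>n\<in>high. (2 powr (lam - 1)) ^ nat (int n - k - 1))"
    unfolding sum_distrib_left by (intro add_mono sum_mono low_term high_term)
  also have "\<dots> \<le> \<rho> powr (- lam) * (1 / (1 - 2 powr (- lam)))
      + \<rho> powr (- lam) * (1 / (1 - 2 powr (lam - 1)))"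
    using \<open>finite low\<close> \<open>finite high\<close> lam
    by (intro add_mono mult_left_mono sum_power_inj_le two_powr_less_1 inj_onI)
      (auto simp: low_def high_def)
  finally show ?thesis by (simp add: dyadic_const_def algebra_simps)
qed

lemma sum_norm_test_function_le:
  assumes annular: "\<And>n. annular_measure (\<nu> n) \<alpha> C x0 U ((1 / 2) ^ n)"
    and "0 < lam" "lam < 1" "finite A" "z \<noteq> x0"
  shows "(\<Sum>n\<in>A. 2 powr (lam * real n) * cmod (test_function (\<nu> n) x0 t z))
    \<le> 2 * C * (near_const \<alpha> + 1) * dyadic_const lam * cmod (z - x0) powr (- lam)"
proof -
  let ?B = "2 * C * (near_const \<alpha> + 1)"
  interpret small_growth_measure "\<nu> 0" \<alpha> C by (rule annular_measure.axioms(1)[OF annular])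
  have "0 \<le> ?B" using C_nonneg near_const_nonneg by simp
  have "(\<Sum>n\<in>A. 2 powr (lam * real n) * cmod (test_function (\<nu> n) x0 t z))
      \<le> (\<Sum>n\<in>A. 2 powr (lam * real n) * (?B * min 1 ((1 / 2) ^ n / cmod (z - x0))))"
    by (intro sum_mono mult_left_mono annular_measure.norm_test_function_le[OF annular])
      (use assms in auto)
  also have "\<dots> = ?B * (\<Sum>n\<in>A. 2 powr (lam * real n) * min 1 ((1 / 2) ^ n / cmod (z - x0)))"
    by (simp add: sum_distrib_left mult_ac)
  also have "\<dots> \<le> ?B * (dyadic_const lam * cmod (z - x0) powr (- lam))"
    using assms \<open>0 \<le> ?B\<close> by (intro mult_left_mono sum_dyadic_min_le) auto
  finally show ?thesis by (simp only: mult.assoc)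
qed

section \<open>Representing measures with finite potential\<close>

lemma inverse_power_le_powr:
  fixes x :: real
  assumes "0 < x" "real k \<le> \<tau>"
  shows "1 / x ^ k \<le> 1 + x powr (- \<tau>)"
proof (cases "1 \<le> x")
  case True
  then have "1 / x ^ k \<le> 1" by (simp add: divide_le_eq_1)
  then show ?thesis by (simp add: add_increasing2)
next
  case False
  have "1 / x ^ k = x powr (- real k)" using assms by (simp add: powr_minus_divide powr_realpow)
  also have "\<dots> \<le> x powr (- \<tau>)" using assms False by (intro powr_mono') auto
  finally show ?thesis by simp
qed

locale finite_potential_representation =
  fixes \<alpha> :: real and U :: "complex set" and x0 :: complex and \<mu> :: "complex measure"
    and \<gamma> :: "complex \<Rightarrow> complex" and t :: nat and lam :: real
  assumes representing: "representing_measure \<alpha> U x0 \<mu> \<gamma>"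
    and finite_potential: "potential \<mu> (real t + lam) x0 \<noteq> \<infinity>"
    and lam: "0 < lam" "lam < 1"
begin

lemma sets_\<mu> [measurable_cong]: "sets \<mu> = sets borel"
  and finite_measure_\<mu>: "finite_measure \<mu>"
  and borel_measurable_\<gamma> [measurable]: "\<gamma> \<in> borel_measurable \<mu>"
  and norm_\<gamma>: "AE z in \<mu>. cmod (\<gamma> z) = 1"
  using representing by (auto simp: representing_measure_def complex_measure_def)

sublocale finite_measure \<mu>
  by (rule finite_measure_\<mu>)

lemma has_bochner_integral_A_alpha:
  "f \<in> A_alpha \<alpha> U \<Longrightarrow> has_bochner_integral \<mu> (\<lambda>z. f z * \<gamma> z) (f x0)"
  using representing by (simp add: representing_measure_def has_bochner_integral_iff)

lemma AE_neq_center: "AE z in \<mu>. z \<noteq> x0"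
proof -
  have "AE z in \<mu>. inverse (ennreal (cmod (z - x0) powr (real t + lam))) \<noteq> \<infinity>"
    using finite_potential unfolding potential_def by (intro nn_integral_PInf_AE) auto
  then show ?thesis by eventually_elim (use lam in auto)
qed

lemma integrable_norm_powr: "integrable \<mu> (\<lambda>z. cmod (z - x0) powr (- (real t + lam)))"
proof -
  have "(\<integral>\<^sup>+z. ennreal (cmod (z - x0) powr (- (real t + lam))) \<partial>\<mu>) = potential \<mu> (real t + lam) x0"
    unfolding potential_def
  proof (rule nn_integral_cong_AE, use AE_neq_center in eventually_elim)
    case (elim z)
    then show ?case
      using powr_minus[of "cmod (z - x0)" "real t + lam"] by (simp add: inverse_ennreal)
  qed
  then show ?thesis using finite_potential by (intro integrableI_nonneg) (auto simp: less_top)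
qed

lemma has_bochner_integral_reciprocal_moment:
  assumes "k \<le> t"
  shows "has_bochner_integral \<mu> (\<lambda>z. \<gamma> z / (z - x0) ^ k) (reciprocal_moment \<mu> \<gamma> x0 k)"
  unfolding reciprocal_moment_def
proof (rule has_bochner_integral_integrable, rule Bochner_Integration.integrable_bound)
  show "integrable \<mu> (\<lambda>z. 1 + cmod (z - x0) powr (- (real t + lam)))"
    using integrable_norm_powr by simp
  show "AE z in \<mu>. cmod (\<gamma> z / (z - x0) ^ k) \<le> norm (1 + cmod (z - x0) powr (- (real t + lam)))"
    using AE_neq_center norm_\<gamma>
  proof eventually_elim
    case (elim z)
    then show ?case
      using inverse_power_le_powr[of "cmod (z - x0)" k "real t + lam"] assms lam
      by (simp add: norm_divide norm_power)
  qed
qed measurable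

definition pairing :: "(complex \<Rightarrow> complex) \<Rightarrow> complex" where
  "pairing f = (LINT z|\<mu>. f z / (z - x0) ^ t * \<gamma> z)"

definition moment_norm :: real where
  "moment_norm = (\<Sum>j<t. cmod (reciprocal_moment \<mu> \<gamma> x0 (Suc j)))"

lemma moment_norm_nonneg: "0 \<le> moment_norm"
  by (simp add: moment_norm_def sum_nonneg)

context
  fixes \<nu> C R
  assumes annular: "annular_measure \<nu> \<alpha> C x0 U R"
begin

interpretation annular_measure \<nu> \<alpha> C x0 U R
  by (rule annular)

lemma has_bochner_integral_test_function:
  "has_bochner_integral \<mu> (\<lambda>z. test_function \<nu> x0 t z / (z - x0) ^ t * \<gamma> z)
    (regular_part \<nu> x0 t x0 + (\<Sum>j<t. reciprocal_moment \<nu> (phase x0 (Suc t)) x0 (t - j)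
      * reciprocal_moment \<mu> \<gamma> x0 (Suc j)))" (is "has_bochner_integral \<mu> ?f ?I")
proof -
  let ?m = "reciprocal_moment \<nu> (phase x0 (Suc t)) x0"
  let ?g = "\<lambda>z. regular_part \<nu> x0 t z * \<gamma> z + (\<Sum>j<t. ?m (t - j) * (\<gamma> z / (z - x0) ^ Suc j))"
  have g: "has_bochner_integral \<mu> ?g ?I"
    by (intro has_bochner_integral_add has_bochner_integral_sum has_bochner_integral_mult_right
        has_bochner_integral_A_alpha regular_part_in_A_alpha
        has_bochner_integral_reciprocal_moment) auto
  have "continuous_on UNIV (test_function \<nu> x0 t)"
    using isCont_lip[OF test_function_in_lip \<alpha>(1)] by (simp add: continuous_on_eq_continuous_at)
  then have [measurable]: "test_function \<nu> x0 t \<in> borel_measurable borel"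
    by (rule borel_measurable_continuous_onI)
  have "AE z in \<mu>. ?f z = ?g z"
    using AE_neq_center
  proof eventually_elim
    case (elim z)
    show ?case
      unfolding test_function_divide_power[OF elim] by (simp add: distrib_right sum_distrib_right)
  qed
  then show ?thesis
    using g has_bochner_integral_cong_AE[of ?f \<mu> ?g ?I] borel_measurable_has_bochner_integral[OF g]
    by simp
qed

lemma Re_pairing_test_function_ge:
  assumes small: "2 ^ Suc t * R * moment_norm \<le> 1"
  shows "(1 / R) ^ Suc t * measure \<nu> (space \<nu>) / 2 \<le> Re (pairing (test_function \<nu> x0 t))"
proof -
  let ?V = "measure \<nu> (space \<nu>)"
  let ?m = "reciprocal_moment \<nu> (phase x0 (Suc t)) x0"
  let ?polar = "\<Sum>j<t. ?m (t - j) * reciprocal_moment \<mu> \<gamma> x0 (Suc j)"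
  have "cmod ?polar \<le> (\<Sum>j<t. (2 / R) ^ t * ?V * cmod (reciprocal_moment \<mu> \<gamma> x0 (Suc j)))"
  proof (rule sum_norm_le)
    fix j
    have "cmod (?m (t - j)) \<le> (2 / R) ^ (t - j) * ?V"
      by (rule norm_reciprocal_moment_phase_le)
    also have "\<dots> \<le> (2 / R) ^ t * ?V" using R by (intro mult_right_mono power_increasing) auto
    finally show "cmod (?m (t - j) * reciprocal_moment \<mu> \<gamma> x0 (Suc j))
        \<le> (2 / R) ^ t * ?V * cmod (reciprocal_moment \<mu> \<gamma> x0 (Suc j))"
      unfolding norm_mult by (rule mult_right_mono) simp
  qed
  also have "\<dots> = (1 / R) ^ Suc t * ?V / 2 * (2 ^ Suc t * R * moment_norm)"
    using R(1)
    by (simp add: moment_norm_def sum_distrib_left sum_distrib_right field_simps)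
  also have "\<dots> \<le> (1 / R) ^ Suc t * ?V / 2"
    using small R(1) moment_norm_nonneg by (intro mult_left_le) auto
  finally have "- Re ?polar \<le> (1 / R) ^ Suc t * ?V / 2" using abs_Re_le_cmod[of ?polar] by linarith
  then show ?thesis
    using Re_regular_part_center_ge[of t]
    unfolding pairing_def has_bochner_integral_integral_eq[OF has_bochner_integral_test_function]
    by simp
qed

end

lemma norm_sum_pairing_le:
  assumes annular: "\<And>n. annular_measure (\<nu> n) \<alpha> C x0 U ((1 / 2) ^ n)" and "finite A"
  shows "cmod (\<Sum>n\<in>A. complex_of_real (2 powr (lam * real n)) * pairing (test_function (\<nu> n) x0 t))
    \<le> 2 * C * (near_const \<alpha> + 1) * dyadic_const lam
      * (LINT z|\<mu>. cmod (z - x0) powr (- (real t + lam)))"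
proof -
  let ?f = "\<lambda>n. test_function (\<nu> n) x0 t"
  let ?w = "\<lambda>n. 2 powr (lam * real n)"
  let ?B = "2 * C * (near_const \<alpha> + 1) * dyadic_const lam"
  let ?s = "\<lambda>z. \<Sum>n\<in>A. complex_of_real (?w n) * (?f n z / (z - x0) ^ t * \<gamma> z)"
  have "integrable \<mu> (\<lambda>z. complex_of_real (?w n) * (?f n z / (z - x0) ^ t * \<gamma> z))" for n
    using has_bochner_integral_test_function[OF annular[of n]]
    by (intro integrable_mult_right) (simp add: has_bochner_integral_iff)
  then have "(\<Sum>n\<in>A. complex_of_real (?w n) * pairing (?f n)) = (LINT z|\<mu>. ?s z)"
    unfolding pairing_def by (simp only: Bochner_Integration.integral_sum integral_mult_right_zero)
  also have "cmod \<dots> \<le> (LINT z|\<mu>. ?B * cmod (z - x0) powr (- (real t + lam)))"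
  proof (rule norm_integral_le_AE)
    show "integrable \<mu> (\<lambda>z. ?B * cmod (z - x0) powr (- (real t + lam)))"
      by (rule integrable_mult_right[OF integrable_norm_powr])
    show "AE z in \<mu>. cmod (?s z) \<le> ?B * cmod (z - x0) powr (- (real t + lam))"
      using AE_neq_center norm_\<gamma>
    proof eventually_elim
      case (elim z)
      define \<rho> where "\<rho> = cmod (z - x0)"
      have "0 < \<rho>" using elim by (simp add: \<rho>_def)
      have "cmod (?s z) \<le> (\<Sum>n\<in>A. ?w n * cmod (?f n z)) * (1 / \<rho> ^ t)"
        unfolding sum_distrib_right
        by (rule sum_norm_le) (use elim(2) in \<open>simp add: norm_mult norm_divide norm_power \<rho>_def\<close>)
      also have "\<dots> \<le> ?B * \<rho> powr (- lam) * (1 / \<rho> ^ t)"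
        unfolding \<rho>_def using annular lam \<open>finite A\<close> elim(1)
        by (intro mult_right_mono sum_norm_test_function_le) auto
      also have "\<dots> = ?B * \<rho> powr (- (real t + lam))"
        using \<open>0 < \<rho>\<close> powr_add[of \<rho> "- real t" "- lam"]
        by (simp add: powr_minus_divide powr_realpow)
      finally show ?case by (simp only: \<rho>_def)
    qed
  qed
  finally show ?thesis by simp
qed

lemma summable_weighted_masses:
  assumes annular: "\<And>n. annular_measure (\<nu> n) \<alpha> C x0 U ((1 / 2) ^ n)"
  shows "summable (\<lambda>n. 2 powr ((real t + lam + 1) * real n) * measure (\<nu> n) (space (\<nu> n)))"
    (is "summable ?a")
proof -
  let ?p = "\<lambda>n. complex_of_real (2 powr (lam * real n)) * pairing (test_function (\<nu> n) x0 t)"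
  obtain B where B: "\<And>A. finite A \<Longrightarrow> cmod (sum ?p A) \<le> B"
    using norm_sum_pairing_le[OF annular] by blast
  obtain N where N: "2 ^ Suc t * moment_norm < 2 ^ N"
    using real_arch_pow[of 2 "2 ^ Suc t * moment_norm"] by auto
  have term_le: "?a n / 2 \<le> Re (?p n)" if "N \<le> n" for n
  proof -
    have "2 ^ Suc t * moment_norm \<le> 2 ^ n"
      using N power_increasing[OF that, of "2 :: real"] by linarith
    then have "2 ^ Suc t * (1 / 2) ^ n * moment_norm \<le> 1" by (simp add: field_simps)
    from mult_left_mono[OF Re_pairing_test_function_ge[OF annular this], of "2 powr (lam * real n)"]
    have "2 powr (lam * real n) * (1 / (1 / 2) ^ n) ^ Suc t * measure (\<nu> n) (space (\<nu> n)) / 2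
        \<le> Re (?p n)"
      by (simp add: mult.assoc del: power_Suc)
    moreover have "2 powr (lam * real n) * (1 / (1 / 2) ^ n) ^ Suc t
        = 2 powr ((real t + lam + 1) * real n)"
    proof -
      have "(1 / (1 / 2 :: real) ^ n) ^ Suc t = 2 powr (real (n * Suc t))"
        by (simp only: powr_realpow) (simp add: power_one_over power_mult power_add)
      then show ?thesis by (simp add: algebra_simps flip: powr_add)
    qed
    ultimately show ?thesis by (simp only:)
  qed
  have "summable (\<lambda>n. ?a (n + N))"
  proof (rule summableI_nonneg_bounded)
    fix m
    let ?A = "(\<lambda>n. n + N) ` {..<m}"
    have "(\<Sum>n<m. ?a (n + N)) = 2 * (\<Sum>n\<in>?A. ?a n / 2)"
      by (subst sum.reindex) (auto simp: sum_divide_distrib[symmetric])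
    also have "\<dots> \<le> 2 * (\<Sum>n\<in>?A. Re (?p n))" by (intro mult_left_mono sum_mono term_le) auto
    also have "(\<Sum>n\<in>?A. Re (?p n)) \<le> B"
      using B[of ?A] complex_Re_le_cmod[of "sum ?p ?A"] by simp
    finally show "(\<Sum>n<m. ?a (n + N)) \<le> 2 * B" by simp
  qed simp
  then show ?thesis by (rule summable_iff_shift[THEN iffD1])
qed

end

theorem theorem6:
  fixes \<alpha> lam :: real and U :: "complex set" and x0 :: complex and t :: nat
  assumes "0 < \<alpha>" "\<alpha> < 1" "open U" "x0 \<in> closure U" "0 < lam" "lam < 1"
    and "(\<Sum>n. ennreal (2 powr ((real t + lam + 1) * real (Suc n))) *
            lower_content \<alpha> (annulus x0 (Suc n) - U)) = \<infinity>"
  shows "spike (real t + lam) \<alpha> U x0"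
  unfolding spike_def
proof (intro allI impI, rule ccontr)
  fix \<mu> \<gamma>
  assume "representing_measure \<alpha> U x0 \<mu> \<gamma>" "potential \<mu> (real t + lam) x0 \<noteq> \<infinity>"
  then interpret finite_potential_representation \<alpha> U x0 \<mu> \<gamma> t lam
    using assms by unfold_locales
  obtain \<nu> where annular: "\<And>n. annular_measure (\<nu> n) \<alpha> (49 * 8 powr (1 + \<alpha>)) x0 U ((1 / 2) ^ n)"
    and content_le:
      "\<And>n. lower_content \<alpha> (annulus x0 n - U) \<le> ennreal (2 * measure (\<nu> n) (space (\<nu> n)))"
    using exists_annular_measure[OF assms(1-3)] by metis
  let ?weight = "\<lambda>n. 2 powr ((real t + lam + 1) * real n)"
  let ?a = "\<lambda>n. 2 * (?weight (Suc n) * measure (\<nu> (Suc n)) (space (\<nu> (Suc n))))"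
  have "summable ?a"
    by (intro summable_mult summable_Suc_iff[THEN iffD2] summable_weighted_masses[OF annular])
  then have "(\<Sum>n. ennreal (?a n)) \<noteq> top" by (rule ennreal_suminf_neq_top) simp
  moreover have
    "ennreal (?weight (Suc n)) * lower_content \<alpha> (annulus x0 (Suc n) - U) \<le> ennreal (?a n)" for n
    using mult_left_mono[OF content_le[of "Suc n"], of "ennreal (?weight (Suc n))"]
    by (simp add: mult_ac flip: ennreal_mult)
  then have "(\<Sum>n. ennreal (?weight (Suc n)) * lower_content \<alpha> (annulus x0 (Suc n) - U))
      \<le> (\<Sum>n. ennreal (?a n))"
    by (intro suminf_le) auto
  ultimately show False using assms(7) by (simp add: top_unique)
qed

end
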